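(* Let $\Phi$ be a homogeneous Poisson point process on $\mathbb{R}^2$ with intensity $\lambda>0$, and let $\Phi^{(2)}$ be the point process of atoms of $\Phi$ that are in mutually nearest neighbour relation with some other atom of $\Phi$. Let $\mathbb{P}^{(2),x}$ denote the Palm probability of $\Phi^{(2)}$ at $x\in\mathbb{R}^2$. Then the nearest neighbour distribution function of $\Phi^{(2)}$ is, for all $r\ge 0$, $$G^{(2)}(r) := \mathbb{P}^{(2),x}\big(d(x,\Phi^{(2)}\setminus \{x\})\leq r\big) = 1-e^{-\lambda\pi r^2 (2-\gamma)},$$ where $\gamma := \frac{2}{3}-\frac{\sqrt{3}}{2\pi}$ and $d(x,B)=\inf_{z\in B}|x-z|$.
   Context: For a locally finite point configuration $\phi\subset\mathbb{R}^2$ and distinct atoms $x,y\in\phi$, write $x\overset{\phi}{\rightarrow} y$ if $y$ is the (a.s. unique) nearest neighbour of $x$ in $\phi\setminus\{x\}$. Atoms $x,y$ are in mutually nearest neighbour relation (MNNR) if $x\overset{\phi}{\rightarrow} y$ and $y\overset{\phi}{\rightarrow} x$. $\Phi^{(2)}$ is the dependent thinning $\{x\in\Phi: x \text{ is in MNNR with some } y\in\Phi\setminus\{x\}\}$; it is stationary. *)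

theory Defs
  imports "HOL-Probability.Probability"
begin

type_synonym pt = "real \<times> real"

definition locally_finite :: "pt set \<Rightarrow> bool" where
  "locally_finite \<phi> \<longleftrightarrow> (\<forall>B. bounded B \<longrightarrow> finite (\<phi> \<inter> B))"

definition nn_rel :: "pt set \<Rightarrow> pt \<Rightarrow> pt \<Rightarrow> bool" where
  "nn_rel \<phi> x y \<longleftrightarrow> x \<in> \<phi> \<and> y \<in> \<phi> \<and> y \<noteq> x \<and>
     (\<forall>z \<in> \<phi> - {x, y}. dist x y < dist x z)"

definition mnnr :: "pt set \<Rightarrow> pt \<Rightarrow> pt \<Rightarrow> bool" where
  "mnnr \<phi> x y \<longleftrightarrow> nn_rel \<phi> x y \<and> nn_rel \<phi> y x"

definition mnnr_thinning :: "pt set \<Rightarrow> pt set" where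
  "mnnr_thinning \<phi> = {x \<in> \<phi>. \<exists>y \<in> \<phi> - {x}. mnnr \<phi> x y}"

definition poisson_process :: "'w measure \<Rightarrow> real \<Rightarrow> ('w \<Rightarrow> pt set) \<Rightarrow> bool" where
  "poisson_process M lam \<Phi> \<longleftrightarrow>
     prob_space M \<and>
     (\<forall>\<omega> \<in> space M. locally_finite (\<Phi> \<omega>)) \<and>
     (\<forall>B \<in> sets lborel. bounded B \<longrightarrow>
        (\<lambda>\<omega>. card (\<Phi> \<omega> \<inter> B)) \<in> measurable M (count_space UNIV) \<and>
        (\<forall>k::nat. measure M {\<omega> \<in> space M. card (\<Phi> \<omega> \<inter> B) = k} =
            (lam * measure lborel B) ^ k / fact k * exp (- (lam * measure lborel B)))) \<and>
     (\<forall>I :: nat set. \<forall>B :: nat \<Rightarrow> pt set.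
        finite I \<longrightarrow> (\<forall>i \<in> I. B i \<in> sets lborel \<and> bounded (B i)) \<longrightarrow> disjoint_family_on B I \<longrightarrow>
        prob_space.indep_vars M (\<lambda>_. count_space UNIV) (\<lambda>i \<omega>. card (\<Phi> \<omega> \<inter> B i)) I)"

text \<open>Palm probability at the origin of a stationary point process Psi on M
  (Palm--Matthes definition via the unit square U):
  P^0(A) = E[ #{y in Psi cap U : Psi - y in A} ] / E[ #(Psi cap U) ].\<close>
definition unit_square :: "pt set" where
  "unit_square = cbox (0, 0) (1, 1)"

definition palm_prob :: "'w measure \<Rightarrow> ('w \<Rightarrow> pt set) \<Rightarrow> pt set set \<Rightarrow> real" where
  "palm_prob M \<Psi> A =
     enn2real (\<integral>\<^sup>+ \<omega>. ennreal (card {y \<in> \<Psi> \<omega> \<inter> unit_square. (\<lambda>z. z - y) ` \<Psi> \<omega> \<in> A}) \<partial>M)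
     / enn2real (\<integral>\<^sup>+ \<omega>. ennreal (card (\<Psi> \<omega> \<inter> unit_square)) \<partial>M)"

definition nn_distribution :: "'w measure \<Rightarrow> ('w \<Rightarrow> pt set) \<Rightarrow> real \<Rightarrow> real" where
  "nn_distribution M \<Psi> r =
     palm_prob M \<Psi> {\<phi>. \<phi> - {0} \<noteq> {} \<and> infdist 0 (\<phi> - {0}) \<le> r}"

end

theory Submission
  imports Defs
begin

text \<open>
  If \<open>x\<close> and \<open>y\<close> are mutually nearest neighbours, then \<open>y\<close> belongs to the thinning as well, so the
  distance from \<open>x\<close> to the rest of the thinning is exactly \<open>\<bar>x - y\<bar>\<close>. The Palm probability is therefore
  the ratio of the expected numbers of pairs \<open>(x, y)\<close> in mutual nearest neighbour relation, \<open>x\<close> in the unit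
  square, with and without the restriction \<open>\<bar>x - y\<bar> \<le> r\<close>. Such a pair is characterised by the absence of
  other points in the union of the two discs of radius \<open>\<bar>x - y\<bar>\<close> around \<open>x\<close> and \<open>y\<close>, whose area is
  \<open>\<kappa> \<bar>x - y\<bar>\<^sup>2\<close> with \<open>\<kappa> = \<pi> (2 - \<gamma>) = 4\<pi>/3 + \<surd>3/2\<close>. Hence the expected number of pairs at distance less
  than \<open>s\<close> is the integral of \<open>\<lambda>\<^sup>2 exp (- \<lambda> \<kappa> \<bar>h\<bar>\<^sup>2)\<close> over \<open>\<bar>h\<bar> < s\<close>.

  Instead of a general Mecke formula, this expectation is obtained by discretisation: on a grid of mesh
  \<open>1/n\<close> one counts the pairs of cells that contain one point each, while a slightly enlarged union of two
  discs contains no further point. These counts involve only finitely many independent Poisson variables,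
  never exceed the number of pairs, and converge to it for every locally finite configuration,
  even in the presence of ties, because the relation requires strict inequalities.
\<close>

section \<open>Area of the union of two discs\<close>

text \<open>On each horizontal line the shear is a translation, so Tonelli reduces the claim to
  translation invariance in dimension one.\<close>

lemma distr_shear_fst:
  "distr lborel borel (\<lambda>z::pt. (fst z + t * snd z, snd z)) = lborel"
proof (rule measure_eqI)
  fix A :: "pt set" assume "A \<in> sets (distr lborel borel (\<lambda>z::pt. (fst z + t * snd z, snd z)))"
  then have A [measurable]: "A \<in> sets borel" by simp
  have [measurable]: "A \<in> sets (borel \<Otimes>\<^sub>M borel)" unfolding borel_prod by (rule A)
  have "emeasure (distr lborel borel (\<lambda>z::pt. (fst z + t * snd z, snd z))) A
      = (\<integral>\<^sup>+ z. indicator A (fst z + t * snd z, snd z) \<partial>(lborel \<Otimes>\<^sub>M lborel))"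
    by (subst nn_integral_indicator[symmetric], simp, subst nn_integral_distr)
      (auto simp: lborel_prod borel_prod intro!: borel_measurable_continuous_onI continuous_intros)
  also have "\<dots> = (\<integral>\<^sup>+ v. (\<integral>\<^sup>+ u. indicator A (u + t * v, v) \<partial>lborel) \<partial>lborel)"
    by (subst lborel_pair.nn_integral_snd[symmetric]) (simp_all add: case_prod_unfold)
  also have "\<dots> = (\<integral>\<^sup>+ v. (\<integral>\<^sup>+ u. indicator A (u, v) \<partial>lborel) \<partial>lborel)"
  proof (rule nn_integral_cong)
    fix v :: real
    show "(\<integral>\<^sup>+ u. indicator A (u + t * v, v) \<partial>lborel) = (\<integral>\<^sup>+ u. indicator A (u, v) \<partial>lborel)"
      by (subst (2) nn_integral_real_affine[of _ 1 "t * v"]) (auto simp: add.commute)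
  qed
  also have "\<dots> = (\<integral>\<^sup>+ z. indicator A z \<partial>(lborel \<Otimes>\<^sub>M lborel))"
    by (subst lborel_pair.nn_integral_snd[symmetric]) simp_all
  finally show "emeasure (distr lborel borel (\<lambda>z::pt. (fst z + t * snd z, snd z))) A = emeasure lborel A"
    by (simp add: lborel_prod)
qed simp

lemma distr_shear_snd:
  "distr lborel borel (\<lambda>z::pt. (fst z, snd z + t * fst z)) = lborel"
proof (rule measure_eqI)
  fix A :: "pt set" assume "A \<in> sets (distr lborel borel (\<lambda>z::pt. (fst z, snd z + t * fst z)))"
  then have A [measurable]: "A \<in> sets borel" by simp
  have [measurable]: "A \<in> sets (borel \<Otimes>\<^sub>M borel)" unfolding borel_prod by (rule A)
  have "emeasure (distr lborel borel (\<lambda>z::pt. (fst z, snd z + t * fst z))) A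
      = (\<integral>\<^sup>+ z. indicator A (fst z, snd z + t * fst z) \<partial>(lborel \<Otimes>\<^sub>M lborel))"
    by (subst nn_integral_indicator[symmetric], simp, subst nn_integral_distr)
      (auto simp: lborel_prod borel_prod intro!: borel_measurable_continuous_onI continuous_intros)
  also have "\<dots> = (\<integral>\<^sup>+ u. (\<integral>\<^sup>+ v. indicator A (u, v + t * u) \<partial>lborel) \<partial>lborel)"
    by (subst lborel.nn_integral_fst[symmetric]) (simp_all add: case_prod_unfold)
  also have "\<dots> = (\<integral>\<^sup>+ u. (\<integral>\<^sup>+ v. indicator A (u, v) \<partial>lborel) \<partial>lborel)"
  proof (rule nn_integral_cong)
    fix u :: real
    show "(\<integral>\<^sup>+ v. indicator A (u, v + t * u) \<partial>lborel) = (\<integral>\<^sup>+ v. indicator A (u, v) \<partial>lborel)"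
      by (subst (2) nn_integral_real_affine[of _ 1 "t * u"]) (auto simp: add.commute)
  qed
  also have "\<dots> = (\<integral>\<^sup>+ z. indicator A z \<partial>(lborel \<Otimes>\<^sub>M lborel))"
    by (subst lborel.nn_integral_fst[symmetric]) simp_all
  finally show "emeasure (distr lborel borel (\<lambda>z::pt. (fst z, snd z + t * fst z))) A = emeasure lborel A"
    by (simp add: lborel_prod)
qed simp

text \<open>A rotation is a product of three shears.\<close>

lemma distr_rotation:
  fixes a b :: real
  assumes ab: "a\<^sup>2 + b\<^sup>2 = 1" and b: "b \<noteq> 0"
  shows "distr lborel borel (\<lambda>z::pt. (a * fst z - b * snd z, b * fst z + a * snd z)) = lborel"
proof -
  \<comment> \<open>In the product \<open>?S\<close> after \<open>?T\<close> after \<open>?S\<close>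
    both diagonal entries are 1 + p b and the upper right one is p (p b + 2). Matching the diagonal
    with a forces this p; the other entry is then -b because a^2 + b^2 = 1.\<close>
  define p where "p = (a - 1) / b"
  let ?S = "\<lambda>z::pt. (fst z + p * snd z, snd z)" and ?T = "\<lambda>z::pt. (fst z, snd z + b * fst z)"
  have [measurable]: "?S \<in> borel \<rightarrow>\<^sub>M borel" "?T \<in> borel \<rightarrow>\<^sub>M borel"
    by (auto intro!: borel_measurable_continuous_onI continuous_intros)
  have pb: "p * b = a - 1" using b by (simp add: p_def)
  have pa: "p * (a + 1) = - b"
    using ab b by (simp add: p_def field_simps power2_eq_square)
  have eq: "?S (?T (?S z)) = (a * fst z - b * snd z, b * fst z + a * snd z)" for z
  proof (cases z)
    case (Pair u v)
    have "u + p * v + p * (v + b * (u + p * v)) = u + p * b * u + v * (p * (p * b + 2))"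
      by (simp add: algebra_simps)
    also have "\<dots> = a * u - b * v" unfolding pb using pa by (simp add: algebra_simps)
    finally have 1: "u + p * v + p * (v + b * (u + p * v)) = a * u - b * v" .
    have "v + b * (u + p * v) = v + b * u + p * b * v" by (simp add: algebra_simps)
    also have "\<dots> = b * u + a * v" unfolding pb by (simp add: algebra_simps)
    finally show ?thesis using 1 Pair by simp
  qed
  have "lborel = distr (distr (distr lborel borel ?S) borel ?T) borel ?S"
    by (simp add: distr_shear_fst distr_shear_snd)
  also have "\<dots> = distr lborel borel (\<lambda>z. ?S (?T (?S z)))"
    by (subst distr_distr, measurable, subst distr_distr, measurable) (simp add: comp_def)
  finally show ?thesis unfolding eq by simp
qed

section \<open>Area of the lens and of the union\<close>

lemma dist_le_iff_square:
  fixes z w :: pt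
  assumes "0 \<le> \<rho>"
  shows "dist z w \<le> \<rho> \<longleftrightarrow> (fst z - fst w)\<^sup>2 + (snd z - snd w)\<^sup>2 \<le> \<rho>\<^sup>2"
proof -
  have "(dist z w)\<^sup>2 = (fst z - fst w)\<^sup>2 + (snd z - snd w)\<^sup>2"
    by (simp add: dist_prod_def dist_real_def)
  then show ?thesis using assms abs_le_square_iff[of "dist z w" \<rho>] by simp
qed

text \<open>The lens is sliced at height v. With s = sqrt (\<rho>^2 - v^2) the slice is the interval
  from \<rho> - s to s, of length 2 s - \<rho>, and it is empty once v^2 exceeds 3/4
  \<rho>^2.\<close>

lemma emeasure_lens_horizontal:
  fixes \<rho> :: real
  assumes "\<rho> > 0"
  shows "emeasure lborel (cball (0, 0) \<rho> \<inter> cball (\<rho>, 0) \<rho> :: pt set)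
     = ennreal ((2 * pi / 3 - sqrt 3 / 2) * \<rho>\<^sup>2)"
proof -
  define L where "L = (cball (0, 0) \<rho> \<inter> cball (\<rho>, 0) \<rho> :: pt set)"
  \<comment> \<open>The two circles meet at height m and -m, above and below the midpoint of the
    centres.\<close>
  define m where "m = sqrt 3 / 2 * \<rho>"
  have m0: "0 < m" "m < \<rho>" "m\<^sup>2 = 3/4 * \<rho>\<^sup>2"
  proof -
    have "sqrt 3 < sqrt 4" by (rule real_sqrt_less_mono) simp
    then have "sqrt 3 < 2" by simp
    then show "0 < m" "m < \<rho>" "m\<^sup>2 = 3/4 * \<rho>\<^sup>2" using assms by (auto simp: m_def power_mult_distrib power_divide)
  qed
  have Lm [measurable]: "L \<in> sets borel" unfolding L_def by simp
  have Lm' [measurable]: "L \<in> sets (borel \<Otimes>\<^sub>M borel)" unfolding borel_prod by (rule Lm)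
  have mem: "(u, v) \<in> L \<longleftrightarrow> u\<^sup>2 + v\<^sup>2 \<le> \<rho>\<^sup>2 \<and> (u - \<rho>)\<^sup>2 + v\<^sup>2 \<le> \<rho>\<^sup>2" for u v
    using assms by (simp add: L_def dist_le_iff_square power2_commute)
  have slice: "emeasure lborel ((\<lambda>u. (u, v)) -` L)
      = ennreal (2 * sqrt (\<rho>\<^sup>2 - v\<^sup>2) - \<rho>) * indicator {-m..m} v" for v
  proof (cases "v \<in> {-m..m}")
    case True
    then have "\<bar>v\<bar> \<le> \<bar>m\<bar>" by auto
    then have v2: "v\<^sup>2 \<le> 3/4 * \<rho>\<^sup>2" using m0(3) by (metis abs_le_square_iff)
    define s where "s = sqrt (\<rho>\<^sup>2 - v\<^sup>2)"
    have s2: "s\<^sup>2 = \<rho>\<^sup>2 - v\<^sup>2" using v2 by (simp add: s_def) (smt (verit) zero_le_power2)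
    have "(\<rho>/2)\<^sup>2 \<le> s\<^sup>2" using v2 s2 by (simp add: power_divide)
    moreover have "s \<ge> 0" unfolding s_def by (simp add: s2[symmetric])
    ultimately have s: "\<rho>/2 \<le> s" using power2_le_imp_le by blast
    have "(\<lambda>u. (u, v)) -` L = {\<rho> - s..s}"
    proof -
      have "u\<^sup>2 + v\<^sup>2 \<le> \<rho>\<^sup>2 \<longleftrightarrow> \<bar>u\<bar> \<le> s" "(u - \<rho>)\<^sup>2 + v\<^sup>2 \<le> \<rho>\<^sup>2 \<longleftrightarrow> \<bar>u - \<rho>\<bar> \<le> s" for u
        using s2 \<open>s \<ge> 0\<close> abs_le_square_iff[of u s] abs_le_square_iff[of "u - \<rho>" s] by auto
      then show ?thesis using s assms by (auto simp: mem)
    qed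
    then show ?thesis using True s by (simp add: s_def)
  next
    case False
    then have "\<bar>m\<bar> < \<bar>v\<bar>" using m0 by auto
    then have v2: "v\<^sup>2 > 3/4 * \<rho>\<^sup>2" using m0(3) by (metis abs_le_square_iff not_le)
    have "(u, v) \<notin> L" for u
    proof
      assume "(u, v) \<in> L"
      \<comment> \<open>The squared horizontal distances to the two centres always sum to at least
        \<rho>^2 / 2, which leaves no room for such a v.\<close>
      then have "u\<^sup>2 + (u - \<rho>)\<^sup>2 < \<rho>\<^sup>2 / 2" using v2 by (simp add: mem)
      moreover have "u\<^sup>2 + (u - \<rho>)\<^sup>2 = 2 * (u - \<rho>/2)\<^sup>2 + \<rho>\<^sup>2/2" by (simp add: power2_eq_square field_simps)
      ultimately show False by (smt (verit) zero_le_power2)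
    qed
    then have "(\<lambda>u. (u, v)) -` L = {}" by auto
    then show ?thesis using False by simp
  qed
  \<comment> \<open>An antiderivative of the slice length; \<open>arcsin\<close> is differentiable
    on the whole range because m < \<rho>.\<close>
  define F where "F v = v * sqrt (\<rho>\<^sup>2 - v\<^sup>2) + \<rho>\<^sup>2 * arcsin (v / \<rho>) - \<rho> * v" for v
  have "emeasure lborel L = (\<integral>\<^sup>+ v. emeasure lborel ((\<lambda>u. (u, v)) -` L) \<partial>lborel)"
    unfolding lborel_prod[symmetric] by (rule lborel_pair.emeasure_pair_measure_alt2) simp
  also have "\<dots> = (\<integral>\<^sup>+ v. ennreal (2 * sqrt (\<rho>\<^sup>2 - v\<^sup>2) - \<rho>) * indicator {-m..m} v \<partial>lborel)"
    by (simp only: slice)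
  also have "\<dots> = F m - F (- m)"
  proof (rule nn_integral_FTC_Icc)
    fix v assume "v \<in> {-m..m}"
    then have "\<bar>v\<bar> \<le> m" by auto
    then have v2: "v\<^sup>2 \<le> 3/4 * \<rho>\<^sup>2" using m0 abs_le_square_iff[of v m] by simp
    have vr: "\<bar>v / \<rho>\<bar> < 1" using \<open>\<bar>v\<bar> \<le> m\<close> m0 assms by simp
    have pos: "\<rho>\<^sup>2 - v\<^sup>2 > 0" using v2 zero_less_power[OF assms, of 2] by linarith
    define s where "s = sqrt (\<rho>\<^sup>2 - v\<^sup>2)"
    have s: "s > 0" "s\<^sup>2 = \<rho>\<^sup>2 - v\<^sup>2" using pos by (auto simp: s_def)
    have sq: "sqrt (1 - (v/\<rho>)\<^sup>2) = s / \<rho>"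
    proof -
      have "1 - (v/\<rho>)\<^sup>2 = (\<rho>\<^sup>2 - v\<^sup>2) / \<rho>\<^sup>2" using assms by (simp add: field_simps)
      then show ?thesis using assms by (simp add: real_sqrt_divide s_def)
    qed
    have "(F has_real_derivative (s + v * (- 2 * v / (2 * s)) + \<rho>\<^sup>2 * (1 / (s/\<rho>) * (1/\<rho>)) - \<rho>)) (at v)"
    proof -
      have d1: "((\<lambda>v. sqrt (\<rho>\<^sup>2 - v\<^sup>2)) has_real_derivative - 2 * v / (2 * s)) (at v)"
        using pos by (auto intro!: derivative_eq_intros simp: s_def field_simps)
      have d2: "((\<lambda>v. arcsin (v / \<rho>)) has_real_derivative 1 / (s/\<rho>) * (1/\<rho>)) (at v)"
        unfolding sq[symmetric] divide_inverse[of 1 "sqrt _"] mult_1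
        using vr[unfolded abs_less_iff] assms
        by (intro DERIV_chain2[OF DERIV_arcsin]) (auto intro!: derivative_eq_intros)
      have "(F has_real_derivative (1 * sqrt (\<rho>\<^sup>2 - v\<^sup>2) + (- 2 * v / (2 * s)) * v) + \<rho>\<^sup>2 * (1 / (s/\<rho>) * (1/\<rho>)) - \<rho> * 1) (at v)"
        unfolding F_def by (intro DERIV_diff DERIV_add DERIV_mult DERIV_ident DERIV_cmult d1 d2)
      then show ?thesis by (simp add: s_def mult_ac)
    qed
    also have "s + v * (- 2 * v / (2 * s)) + \<rho>\<^sup>2 * (1 / (s/\<rho>) * (1/\<rho>)) - \<rho> = s + (\<rho>\<^sup>2 - v\<^sup>2) / s - \<rho>"
      using s assms by (simp add: field_simps power2_eq_square)
    also have "\<dots> = 2 * s - \<rho>" using s(1) unfolding s(2)[symmetric] by (simp add: power2_eq_square)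
    finally show "(F has_real_derivative 2 * sqrt (\<rho>\<^sup>2 - v\<^sup>2) - \<rho>) (at v)" by (simp add: s_def)
    have "(\<rho>/2)\<^sup>2 \<le> s\<^sup>2" using v2 s by (simp add: power_divide)
    then have "\<rho>/2 \<le> s" using s(1) power2_le_imp_le[of "\<rho>/2" s] by simp
    then show "0 \<le> 2 * sqrt (\<rho>\<^sup>2 - v\<^sup>2) - \<rho>" by (simp add: s_def)
  qed (use m0 in auto)
  also have "F m - F (- m) = (2 * pi / 3 - sqrt 3 / 2) * \<rho>\<^sup>2"
  proof -
    have a1: "sqrt (\<rho>\<^sup>2 - m\<^sup>2) = \<rho> / 2"
      using assms by (intro real_sqrt_unique) (auto simp: m0(3) power_divide)
    have a2: "arcsin (m / \<rho>) = pi / 3"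
    proof -
      have "m / \<rho> = sin (pi/3)" using assms by (simp add: m_def sin_60)
      then show ?thesis using arcsin_sin[of "pi/3"] pi_gt_zero by simp
    qed
    have a3: "arcsin (- m / \<rho>) = - arcsin (m / \<rho>)"
      unfolding minus_divide_left[symmetric]
      using m0 assms order_trans[of "-1" 0 "m / \<rho>"] by (intro arcsin_minus) auto
    have "F m - F (- m) = 2 * (m * (\<rho> / 2) + \<rho>\<^sup>2 * (pi / 3) - \<rho> * m)"
      unfolding F_def power2_minus a3 a1 a2 by simp
    then show ?thesis by (simp add: m_def power2_eq_square field_simps)
  qed
  finally show ?thesis by (simp add: L_def)
qed

text \<open>The rotation with cosine a and sine b takes (\<rho>, 0) to h, so it pulls the lens back
  to the horizontal one. Since \<open>distr_rotation\<close> requires a nonzero sine, horizontal h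
  is treated separately.\<close>

lemma emeasure_lens_origin:
  fixes h :: pt
  assumes "h \<noteq> 0"
  shows "emeasure lborel (cball 0 (norm h) \<inter> cball h (norm h))
     = ennreal ((2 * pi / 3 - sqrt 3 / 2) * (norm h)\<^sup>2)"
proof -
  obtain p q where h: "h = (p, q)" by (cases h)
  define \<rho> where "\<rho> = norm h"
  have \<rho>: "\<rho> > 0" using assms by (simp add: \<rho>_def)
  have \<rho>2: "\<rho>\<^sup>2 = p\<^sup>2 + q\<^sup>2" by (simp add: \<rho>_def h norm_prod_def)
  let ?L = "cball (0, 0) \<rho> \<inter> cball (\<rho>, 0) \<rho> :: pt set"
  have "emeasure lborel (cball 0 \<rho> \<inter> cball h \<rho>) = emeasure lborel ?L"
  proof (cases "q = 0")
    case True
    then have "p = \<rho> \<or> p = - \<rho>" using \<rho>2 by (auto simp: power2_eq_iff)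
    then show ?thesis
    proof
      assume "p = \<rho>" then show ?thesis using True by (simp add: h zero_prod_def)
    next
      assume p: "p = - \<rho>"
      \<comment> \<open>Translation by h carries the centres (0, 0) and (\<rho>, 0) to h and 0; it
        takes the place of the half turn.\<close>
      have "emeasure lborel (cball 0 \<rho> \<inter> cball h \<rho>)
        = emeasure (distr lborel borel ((+) h)) (cball 0 \<rho> \<inter> cball h \<rho>)"
        by (simp add: lborel_distr_plus)
      also have "\<dots> = emeasure lborel ((+) h -` (cball 0 \<rho> \<inter> cball h \<rho>))"
        by (subst emeasure_distr) auto
      also have "(+) h -` (cball 0 \<rho> \<inter> cball h \<rho>) = ?L"
        using True p by (auto simp: h dist_norm norm_prod_def power2_commute add.commute)
      finally show ?thesis .
    qed
  next
    case False
    define a b where "a = p / \<rho>" and "b = q / \<rho>"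
    have ab: "a\<^sup>2 + b\<^sup>2 = 1" "b \<noteq> 0"
      using False \<rho> \<rho>2 by (auto simp: a_def b_def power_divide add_divide_distrib[symmetric])
    have pq: "p = \<rho> * a" "q = \<rho> * b" using \<rho> by (auto simp: a_def b_def)
    let ?R = "\<lambda>z::pt. (a * fst z - b * snd z, b * fst z + a * snd z)"
    have [measurable]: "?R \<in> borel \<rightarrow>\<^sub>M borel"
      by (auto intro!: borel_measurable_continuous_onI continuous_intros)
    have iso: "(a * u - b * v)\<^sup>2 + (b * u + a * v)\<^sup>2 = u\<^sup>2 + v\<^sup>2" for u v
    proof -
      have "(a * u - b * v)\<^sup>2 + (b * u + a * v)\<^sup>2 = (a\<^sup>2 + b\<^sup>2) * (u\<^sup>2 + v\<^sup>2)"
        by (simp add: power2_eq_square algebra_simps)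
      then show ?thesis using ab by simp
    qed
    have "emeasure lborel (cball 0 \<rho> \<inter> cball h \<rho>)
      = emeasure (distr lborel borel ?R) (cball 0 \<rho> \<inter> cball h \<rho>)"
      by (simp only: distr_rotation[OF ab])
    also have "\<dots> = emeasure lborel (?R -` (cball 0 \<rho> \<inter> cball h \<rho>))"
      by (subst emeasure_distr) auto
    also have "?R -` (cball 0 \<rho> \<inter> cball h \<rho>) = ?L"
    proof -
      have "(p - (a * u - b * v))\<^sup>2 + (q - (b * u + a * v))\<^sup>2 = (\<rho> - u)\<^sup>2 + (0 - v)\<^sup>2" for u v
        using iso[of "\<rho> - u" "- v"] by (simp add: pq algebra_simps)
      moreover have "(0 - (a * u - b * v))\<^sup>2 + (0 - (b * u + a * v))\<^sup>2 = (0 - u)\<^sup>2 + (0 - v)\<^sup>2" for u v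
        using iso[of u v] by (simp add: power2_eq_square algebra_simps)
      ultimately show ?thesis
        using \<rho> by (simp add: set_eq_iff h dist_le_iff_square zero_prod_def del: dist_0_norm diff_0)
    qed
    finally show ?thesis .
  qed
  then show ?thesis using emeasure_lens_horizontal[OF \<rho>] by (simp add: \<rho>_def)
qed

text \<open>Inclusion-exclusion: twice \<pi> \<rho>^2 minus the lens area, after a translation that
  brings x to the origin.\<close>

lemma measure_two_discs:
  fixes x y :: pt
  shows "measure lborel (cball x (dist x y) \<union> cball y (dist x y))
     = (4 * pi / 3 + sqrt 3 / 2) * (dist x y)\<^sup>2"
proof (cases "x = y")
  case False
  define \<rho> where "\<rho> = dist x y"
  have \<rho>: "\<rho> = norm (y - x)" by (simp add: \<rho>_def dist_norm norm_minus_commute)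
  have "emeasure lborel (cball x \<rho> \<inter> cball y \<rho>)
    = emeasure (distr lborel borel ((+) x)) (cball x \<rho> \<inter> cball y \<rho>)"
    by (simp add: lborel_distr_plus)
  also have "\<dots> = emeasure lborel ((+) x -` (cball x \<rho> \<inter> cball y \<rho>))"
    by (subst emeasure_distr) auto
  also have "(+) x -` (cball x \<rho> \<inter> cball y \<rho>) = cball 0 (norm (y - x)) \<inter> cball (y - x) (norm (y - x))"
    by (simp add: set_eq_iff \<rho> dist_norm diff_diff_eq)
  also have "emeasure lborel \<dots> = ennreal ((2 * pi / 3 - sqrt 3 / 2) * \<rho>\<^sup>2)"
    using False by (subst emeasure_lens_origin) (auto simp: \<rho>)
  finally have "emeasure lborel (cball x \<rho> \<inter> cball y \<rho>) = ennreal ((2 * pi / 3 - sqrt 3 / 2) * \<rho>\<^sup>2)" .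
  \<comment> \<open>\<open>ennreal\<close> truncates negative numbers to zero, so the real value of
    the lens area can be read off only once the constant is known to be nonnegative.\<close>
  moreover have "sqrt 3 / 2 \<le> 2 * pi / 3"
  proof -
    have "sqrt 3 \<le> sqrt 4" by (rule real_sqrt_le_mono) simp
    then show ?thesis using pi_gt3 by simp
  qed
  ultimately have lens: "measure lborel (cball x \<rho> \<inter> cball y \<rho>) = (2 * pi / 3 - sqrt 3 / 2) * \<rho>\<^sup>2"
    by (simp add: measure_def)
  have disc: "measure lborel (cball z \<rho>) = pi * \<rho>\<^sup>2" for z :: pt
    by (simp add: \<rho> content_cball unit_ball_vol_2 power2_eq_square)
  have "measure lborel (cball x \<rho> \<union> cball y \<rho>)
     = measure lborel (cball x \<rho>) + measure lborel (cball y \<rho>) - measure lborel (cball x \<rho> \<inter> cball y \<rho>)"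
    using emeasure_lborel_cball_finite by (intro measure_Un3 fmeasurableI) auto
  then show ?thesis unfolding disc lens \<rho>_def[symmetric] by (simp add: field_simps)
qed simp

section \<open>A radial integral\<close>

lemma nn_integral_radial_exp:
  fixes b s :: real
  assumes "b > 0" "s \<ge> 0"
  shows "(\<integral>\<^sup>+ h. indicator (ball (0::pt) s) h * ennreal (exp (- b * (norm h)\<^sup>2)) \<partial>lborel)
    = ennreal (pi / b * (1 - exp (- b * s\<^sup>2)))"
proof -
  have disc: "emeasure lborel (ball (0::pt) \<rho>) = ennreal (pi * \<rho>\<^sup>2)" if "\<rho> \<ge> 0" for \<rho>
    using that by (simp add: emeasure_ball unit_ball_vol_2 power2_eq_square)
  \<comment> \<open>f is minus the derivative of exp (- b \<rho>^2).\<close>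
  define f where "f \<rho> = 2 * b * \<rho> * exp (- b * \<rho>\<^sup>2)" for \<rho>
  have [measurable]: "f \<in> borel_measurable borel" unfolding f_def by measurable
  \<comment> \<open>Writing the integrand as a superposition of indicators of discs replaces polar coordinates.\<close>
  have layer: "indicator (ball 0 s) h * ennreal (exp (- b * (norm h)\<^sup>2))
     = indicator (ball 0 s) h * ennreal (exp (- b * s\<^sup>2))
       + (\<integral>\<^sup>+ \<rho>. ennreal (f \<rho>) * indicator {0..s} \<rho> * indicator (ball 0 \<rho>) h \<partial>lborel)" for h :: pt
  proof (cases "norm h < s")
    case True
    \<comment> \<open>The open disc of radius \<open>norm h\<close> misses h while the closed
      interval contains that radius; one radius is a null set.\<close>
    have "(\<integral>\<^sup>+ \<rho>. ennreal (f \<rho>) * indicator {0..s} \<rho> * indicator (ball 0 \<rho>) h \<partial>lborel)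
      = (\<integral>\<^sup>+ \<rho>. ennreal (f \<rho>) * indicator {norm h..s} \<rho> \<partial>lborel)"
      using AE_lborel_singleton[of "norm h"]
      by (intro nn_integral_cong_AE, eventually_elim)
        (auto split: split_indicator simp: dist_norm intro: order_trans[OF norm_ge_zero])
    also have "\<dots> = (- exp (- b * s\<^sup>2)) - (- exp (- b * (norm h)\<^sup>2))"
      using True assms unfolding f_def
      by (intro nn_integral_FTC_Icc)
        (auto intro!: derivative_eq_intros mult_nonneg_nonneg simp: order_trans[OF norm_ge_zero])
    finally have *: "(\<integral>\<^sup>+ \<rho>. ennreal (f \<rho>) * indicator {0..s} \<rho> * indicator (ball 0 \<rho>) h \<partial>lborel)
       = ennreal (exp (- b * (norm h)\<^sup>2) - exp (- b * s\<^sup>2))" by simp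
    have "exp (- b * s\<^sup>2) \<le> exp (- b * (norm h)\<^sup>2)"
      using True assms by (simp add: power_mono)
    then show ?thesis unfolding * using True by (simp add: ennreal_plus[symmetric] del: ennreal_plus)
  next
    case False
    then have "(\<integral>\<^sup>+ \<rho>. ennreal (f \<rho>) * indicator {0..s} \<rho> * indicator (ball 0 \<rho>) h \<partial>lborel) = (\<integral>\<^sup>+ (\<rho>::real). 0 \<partial>lborel)"
      by (intro nn_integral_cong) (auto split: split_indicator simp: dist_norm)
    then show ?thesis using False by simp
  qed
  have mble: "Measurable.pred (borel \<Otimes>\<^sub>M borel) (\<lambda>z::pt \<times> real. fst z \<in> ball 0 (snd z))"
    by (simp add: dist_norm)
  have "(\<integral>\<^sup>+ h. (\<integral>\<^sup>+ \<rho>. ennreal (f \<rho>) * indicator {0..s} \<rho> * indicator (ball (0::pt) \<rho>) h \<partial>lborel) \<partial>lborel)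
     = (\<integral>\<^sup>+ \<rho>. (\<integral>\<^sup>+ h. ennreal (f \<rho>) * indicator {0..s} \<rho> * indicator (ball (0::pt) \<rho>) h \<partial>lborel) \<partial>lborel)"
    using mble by (intro lborel_pair.Fubini'[symmetric]) (simp add: indicator_def case_prod_unfold)
  also have "\<dots> = (\<integral>\<^sup>+ \<rho>. ennreal (pi * \<rho>\<^sup>2 * f \<rho>) * indicator {0..s} \<rho> \<partial>lborel)"
  proof (rule nn_integral_cong)
    fix \<rho> :: real
    show "(\<integral>\<^sup>+ h. ennreal (f \<rho>) * indicator {0..s} \<rho> * indicator (ball (0::pt) \<rho>) h \<partial>lborel)
      = ennreal (pi * \<rho>\<^sup>2 * f \<rho>) * indicator {0..s} \<rho>"
    proof (cases "\<rho> \<in> {0..s}")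
      case True
      then have "f \<rho> \<ge> 0" using assms by (simp add: f_def)
      then show ?thesis
        using True by (simp add: nn_integral_cmult_indicator disc ennreal_mult'[symmetric] mult.commute)
    qed simp
  qed
  \<comment> \<open>The antiderivative comes from integration by parts.\<close>
  also have "\<dots> = (- pi * s\<^sup>2 * exp (- b * s\<^sup>2) - pi / b * exp (- b * s\<^sup>2))
      - (- pi * 0\<^sup>2 * exp (- b * 0\<^sup>2) - pi / b * exp (- b * 0\<^sup>2))"
    using assms unfolding f_def
    by (intro nn_integral_FTC_Icc)
      (auto intro!: derivative_eq_intros mult_nonneg_nonneg simp: field_simps power2_eq_square)
  finally have "(\<integral>\<^sup>+ h. (\<integral>\<^sup>+ \<rho>. ennreal (f \<rho>) * indicator {0..s} \<rho> * indicator (ball (0::pt) \<rho>) h \<partial>lborel) \<partial>lborel)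
     = ennreal (pi / b * (1 - exp (- b * s\<^sup>2)) - pi * s\<^sup>2 * exp (- b * s\<^sup>2))"
    by (simp add: algebra_simps)
  \<comment> \<open>Adding the two \<open>ennreal\<close> terms requires nonnegativity, which is the
    inequality 1 + t \<le> exp t at t = b s^2.\<close>
  moreover have "0 \<le> pi / b * (1 - exp (- b * s\<^sup>2)) - pi * s\<^sup>2 * exp (- b * s\<^sup>2)"
  proof -
    have "1 + b * s\<^sup>2 \<le> exp (b * s\<^sup>2)" by (rule exp_ge_add_one_self)
    then have "(1 + b * s\<^sup>2) * exp (- (b * s\<^sup>2)) \<le> exp (b * s\<^sup>2) * exp (- (b * s\<^sup>2))"
      by (intro mult_right_mono) auto
    then have "0 \<le> pi / b * (1 - (1 + b * s\<^sup>2) * exp (- (b * s\<^sup>2)))"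
      using assms by (simp add: exp_minus_inverse)
    then show ?thesis using assms by (simp add: field_simps)
  qed
  moreover have "(\<integral>\<^sup>+ h. indicator (ball (0::pt) s) h * ennreal (exp (- b * s\<^sup>2)) \<partial>lborel)
     = ennreal (pi * s\<^sup>2 * exp (- b * s\<^sup>2))"
    unfolding mult.commute[of "indicator _ _"]
    using assms by (subst nn_integral_cmult_indicator) (simp_all add: disc ennreal_mult'[symmetric] mult.commute)
  moreover have "(\<lambda>h. \<integral>\<^sup>+ \<rho>. ennreal (f \<rho>) * indicator {0..s} \<rho> * indicator (ball (0::pt) \<rho>) h \<partial>lborel) \<in> borel_measurable lborel"
    using mble by (intro lborel.borel_measurable_nn_integral) (simp add: indicator_def case_prod_unfold)
  moreover have "(\<lambda>h. indicator (ball (0::pt) s) h * ennreal (exp (- b * s\<^sup>2))) \<in> borel_measurable lborel"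
    by (intro borel_measurable_times_ennreal borel_measurable_indicator borel_measurable_const) simp
  ultimately show ?thesis
    unfolding layer by (subst nn_integral_add) (simp_all add: ennreal_plus[symmetric] del: ennreal_plus)
qed

section \<open>Mutually nearest neighbours\<close>

lemma locally_finiteD: "locally_finite \<phi> \<Longrightarrow> bounded B \<Longrightarrow> finite (\<phi> \<inter> B)"
  by (simp add: locally_finite_def)

text \<open>Two different partners of x would each be strictly closer to x than the other. This is
  what lets pairs be counted by their first component.\<close>

lemma mnnr_unique: "mnnr \<phi> x y \<Longrightarrow> mnnr \<phi> x z \<Longrightarrow> y = z"
  unfolding mnnr_def nn_rel_def by (metis DiffI insertE order_less_asym singletonD)

lemma mnnr_sym: "mnnr \<phi> x y \<Longrightarrow> mnnr \<phi> y x"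
  by (simp add: mnnr_def)

lemma mnnr_mem: assumes "mnnr \<phi> x y" shows "x \<in> \<phi>" "y \<in> \<phi>" "x \<noteq> y"
  using assms by (auto simp: mnnr_def nn_rel_def)

lemma mnnr_thinning_iff: "x \<in> mnnr_thinning \<phi> \<longleftrightarrow> (\<exists>y. mnnr \<phi> x y)"
  by (auto simp: mnnr_thinning_def dest: mnnr_mem)

lemma mnnr_dist_less: "mnnr \<phi> x y \<Longrightarrow> z \<in> \<phi> \<Longrightarrow> z \<noteq> x \<Longrightarrow> z \<noteq> y \<Longrightarrow> dist x y < dist x z"
  by (simp add: mnnr_def nn_rel_def)

lemma bounded_unit_square [simp]: "bounded unit_square"
  by (simp add: unit_square_def)

lemma unit_square_borel [simp, measurable]: "unit_square \<in> sets borel"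
  by (simp add: unit_square_def)

lemma emeasure_unit_square: "emeasure lborel unit_square = 1"
  by (simp add: unit_square_def lborel_prod[symmetric] cbox_Pair_eq lborel.emeasure_pair_measure_Times)

text \<open>The partner y survives the thinning by symmetry, and every other surviving point already
  belongs to \<phi>, hence is no closer to x. The nonemptiness clause guards against the default
  value 0 of \<open>infdist\<close> on the empty set.\<close>

lemma shifted_thinning_infdist_iff:
  fixes r :: real
  assumes xy: "mnnr \<phi> x y"
  defines "\<psi> \<equiv> (\<lambda>z. z - x) ` mnnr_thinning \<phi>"
  shows "(\<psi> - {0} \<noteq> {} \<and> infdist 0 (\<psi> - {0}) \<le> r) \<longleftrightarrow> dist x y \<le> r"
proof -
  have "y \<in> mnnr_thinning \<phi>" unfolding mnnr_thinning_iff using mnnr_sym[OF xy] by blast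
  then have mem: "y - x \<in> \<psi> - {0}" using mnnr_mem[OF xy] by (simp add: \<psi>_def)
  have "infdist 0 (\<psi> - {0}) = dist x y"
  proof (rule antisym)
    show "infdist 0 (\<psi> - {0}) \<le> dist x y"
      using infdist_le[OF mem, of 0] by (simp add: dist_norm norm_minus_commute)
    have "dist x y \<le> dist 0 w" if w: "w \<in> \<psi> - {0}" for w
    proof -
      obtain z where z: "w = z - x" "z \<in> mnnr_thinning \<phi>" using w unfolding \<psi>_def by blast
      have "z \<noteq> x" using w z by auto
      moreover have "z \<in> \<phi>" using z by (simp add: mnnr_thinning_def)
      ultimately have "dist x y \<le> dist x z"
        using mnnr_dist_less[OF xy, of z] by (cases "z = y") auto
      then show ?thesis using z by (simp add: dist_norm norm_minus_commute)
    qed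
    then show "dist x y \<le> infdist 0 (\<psi> - {0})"
      using mem by (subst infdist_notempty) (auto intro!: cINF_greatest)
  qed
  then show ?thesis using mem by auto
qed

section \<open>Detection of the pairs on a grid\<close>

text \<open>Rounding down makes the cells half-open squares for positive n, so they partition the
  plane and every point has exactly one index.\<close>

definition grid_index :: "nat \<Rightarrow> pt \<Rightarrow> int \<times> int" where
  "grid_index n x = (\<lfloor>real n * fst x\<rfloor>, \<lfloor>real n * snd x\<rfloor>)"

definition grid_cell :: "nat \<Rightarrow> int \<times> int \<Rightarrow> pt set" where
  "grid_cell n i = {x. grid_index n x = i}"

definition grid_corner :: "nat \<Rightarrow> int \<times> int \<Rightarrow> pt" where
  "grid_corner n i = (of_int (fst i) / real n, of_int (snd i) / real n)"

text \<open>
  The radius is enlarged by \<open>6/n\<close> so that the zone contains the two discs around \<open>x\<close> and \<open>y\<close> for every \<open>x\<close>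
  in the cell \<open>i\<close> and \<open>y\<close> in the cell \<open>j\<close>.
\<close>

definition grid_zone :: "nat \<Rightarrow> int \<times> int \<Rightarrow> int \<times> int \<Rightarrow> pt set" where
  "grid_zone n i j = (let c = grid_corner n i; d = grid_corner n j; \<rho> = dist c d + 6 / real n
     in cball c \<rho> \<union> cball d \<rho>)"

text \<open>
  The box of indices covers \<open>[-n, n]\<^sup>2\<close>, hence eventually every bounded set; the margin \<open>4/n\<close> ensures that
  points in the two cells are at distance less than \<open>s\<close>.
\<close>

definition grid_pairs :: "nat \<Rightarrow> real \<Rightarrow> ((int \<times> int) \<times> (int \<times> int)) set" where
  "grid_pairs n s = (let K = {- int (n * n)..int (n * n)} in
     {(i, j). i \<in> K \<times> K \<and> j \<in> K \<times> K \<and> i \<noteq> j \<and>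
       dist (grid_corner n i) (grid_corner n j) + 4 / real n < s})"

text \<open>The three counts concern disjoint bounded Borel sets, so their joint probability
  factorises. Restricting the first cell to the unit square puts the rest of that cell into the
  region required to be void.\<close>

definition detected_pairs :: "nat \<Rightarrow> real \<Rightarrow> pt set \<Rightarrow> ((int \<times> int) \<times> (int \<times> int)) set" where
  "detected_pairs n s \<phi> = {(i, j) \<in> grid_pairs n s.
     card (\<phi> \<inter> (grid_cell n i \<inter> unit_square)) = 1 \<and> card (\<phi> \<inter> grid_cell n j) = 1 \<and>
     card (\<phi> \<inter> (grid_zone n i j - (grid_cell n i \<inter> unit_square) - grid_cell n j)) = 0}"

text \<open>The strict bound on the distance leaves room for the margin of the grid; the closed
  bound of the theorem is recovered at the end by continuity in s.\<close>

definition mnnr_pairs :: "real \<Rightarrow> pt set \<Rightarrow> (pt \<times> pt) set" where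
  "mnnr_pairs s \<phi> = {(x, y). x \<in> unit_square \<and> mnnr \<phi> x y \<and> dist x y < s}"

lemma finite_grid_pairs [simp]: "finite (grid_pairs n s)"
proof -
  let ?K = "{- int (n * n)..int (n * n)}"
  have "grid_pairs n s \<subseteq> (?K \<times> ?K) \<times> (?K \<times> ?K)" by (auto simp: grid_pairs_def Let_def)
  then show ?thesis by (rule finite_subset) simp
qed

section \<open>Rounding errors of the grid\<close>

text \<open>Each coordinate contributes at most 1/n. The later constants accumulate this error: 4/n
  for moving both ends of a segment to corners, 6/n = 2/n + 4/n for the zone to contain the two
  discs, and 12/n = 2/n + 4/n + 6/n for discs that contain the zone.\<close>

lemma dist_grid_corner:
  assumes "n > 0"
  shows "dist x (grid_corner n (grid_index n x)) \<le> 2 / real n"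
proof -
  have *: "\<bar>t - of_int \<lfloor>real n * t\<rfloor> / real n\<bar> \<le> 1 / real n" for t :: real
  proof -
    have "t - of_int \<lfloor>real n * t\<rfloor> / real n = (real n * t - of_int \<lfloor>real n * t\<rfloor>) / real n"
      using assms by (simp add: field_simps)
    moreover have "0 \<le> real n * t - of_int \<lfloor>real n * t\<rfloor>" "real n * t - of_int \<lfloor>real n * t\<rfloor> \<le> 1"
      by linarith+
    ultimately show ?thesis using assms by (simp add: divide_right_mono)
  qed
  have "dist x (grid_corner n (grid_index n x)) \<le>
     dist (fst x) (of_int \<lfloor>real n * fst x\<rfloor> / real n) + dist (snd x) (of_int \<lfloor>real n * snd x\<rfloor> / real n)"
    by (simp add: dist_prod_def grid_corner_def grid_index_def sqrt_sum_squares_le_sum)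
  also have "\<dots> \<le> 1 / real n + 1 / real n"
    using *[of "fst x"] *[of "snd x"] by (intro add_mono) (auto simp: dist_real_def)
  finally show ?thesis by simp
qed

lemma dist_grid_corners:
  assumes "n > 0"
  defines "c \<equiv> \<lambda>x. grid_corner n (grid_index n x)"
  shows "dist (c x) (c y) \<le> dist x y + 4 / real n" "dist x y \<le> dist (c x) (c y) + 4 / real n"
proof -
  have "dist (c x) (c y) \<le> dist x y + (2 / real n + 2 / real n)"
       "dist x y \<le> dist (c x) (c y) + (2 / real n + 2 / real n)"
    using dist_grid_corner[OF assms(1), of x] dist_grid_corner[OF assms(1), of y]
      dist_triangle[of "c x" "c y" x] dist_triangle[of x "c y" y]
      dist_triangle[of x y "c x"] dist_triangle[of "c x" y "c y"]
    by (simp_all add: c_def dist_commute)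
  then show "dist (c x) (c y) \<le> dist x y + 4 / real n" "dist x y \<le> dist (c x) (c y) + 4 / real n"
    by simp_all
qed

lemma dist_same_cell:
  assumes "n > 0" "grid_index n x = grid_index n y"
  shows "dist x y \<le> 4 / real n"
  using dist_grid_corners(2)[OF assms(1), of x y] assms(2) by simp

lemma grid_cell_subset_cball:
  "n > 0 \<Longrightarrow> grid_cell n i \<subseteq> cball (grid_corner n i) (2 / real n)"
  using dist_grid_corner[of n] by (auto simp: grid_cell_def dist_commute)

lemma bounded_grid_cell: "n > 0 \<Longrightarrow> bounded (grid_cell n i)"
  by (rule bounded_subset[OF bounded_cball grid_cell_subset_cball])

lemma grid_index_measurable [measurable]: "grid_index n \<in> borel \<rightarrow>\<^sub>M count_space UNIV"
proof -
  have "(\<lambda>x::pt. \<lfloor>real n * fst x\<rfloor>) \<in> borel \<rightarrow>\<^sub>M count_space UNIV"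
    "(\<lambda>x::pt. \<lfloor>real n * snd x\<rfloor>) \<in> borel \<rightarrow>\<^sub>M count_space UNIV"
    by (auto intro!: measurable_compose[OF _ measurable_real_floor] borel_measurable_continuous_onI continuous_intros)
  then have "(\<lambda>x. (\<lfloor>real n * fst x\<rfloor>, \<lfloor>real n * snd x\<rfloor>)) \<in> borel \<rightarrow>\<^sub>M count_space UNIV \<Otimes>\<^sub>M count_space UNIV"
    by (rule measurable_Pair)
  then show ?thesis by (simp add: pair_measure_countable grid_index_def[abs_def])
qed

lemma grid_cell_borel [measurable]: "grid_cell n i \<in> sets borel"
  unfolding grid_cell_def by measurable

lemma grid_zone_borel [measurable]: "grid_zone n i j \<in> sets borel"
  by (simp add: grid_zone_def Let_def)

lemma bounded_grid_zone: "bounded (grid_zone n i j)"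
  by (simp add: grid_zone_def Let_def)

lemma grid_cells_subset_zone:
  "n > 0 \<Longrightarrow> grid_cell n i \<union> grid_cell n j \<subseteq> grid_zone n i j"
proof -
  assume n: "n > 0"
  have "2 / real n \<le> dist (grid_corner n i) (grid_corner n j) + 6 / real n"
    by (rule order_trans[of _ "6 / real n"]) (auto intro: divide_right_mono)
  then show ?thesis
    using grid_cell_subset_cball[OF n, of i] grid_cell_subset_cball[OF n, of j]
    by (fastforce simp: grid_zone_def Let_def)
qed

lemma in_grid_zone:
  assumes n: "n > 0" and z: "dist x z \<le> dist x y \<or> dist y z \<le> dist x y"
  shows "z \<in> grid_zone n (grid_index n x) (grid_index n y)"
proof -
  define c where "c x = grid_corner n (grid_index n x)" for x
  have *: "2 / real n + 4 / real n = 6 / real n" by simp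
  have "dist (c x) z \<le> dist (c x) (c y) + 6 / real n \<or> dist (c y) z \<le> dist (c x) (c y) + 6 / real n"
    using z dist_grid_corner[OF n, of x] dist_grid_corner[OF n, of y] dist_grid_corners(2)[OF n, of x y]
      dist_triangle[of "c x" z x] dist_triangle[of "c y" z y]
    unfolding *[symmetric] by (auto simp: c_def dist_commute)
  then show ?thesis by (auto simp: grid_zone_def Let_def c_def)
qed

lemma grid_zone_subset:
  assumes n: "n > 0"
  shows "grid_zone n (grid_index n x) (grid_index n y)
    \<subseteq> cball x (dist x y + 12 / real n) \<union> cball y (dist x y + 12 / real n)"
proof
  define c where "c x = grid_corner n (grid_index n x)" for x
  fix z assume "z \<in> grid_zone n (grid_index n x) (grid_index n y)"
  then have z: "dist (c x) z \<le> dist (c x) (c y) + 6 / real n \<or> dist (c y) z \<le> dist (c x) (c y) + 6 / real n"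
    by (auto simp: grid_zone_def Let_def c_def)
  have *: "2 / real n + 4 / real n + 6 / real n = 12 / real n" by (simp add: add_divide_distrib[symmetric])
  have "dist x z \<le> dist x y + 12 / real n \<or> dist y z \<le> dist x y + 12 / real n"
    using z dist_grid_corner[OF n, of x] dist_grid_corner[OF n, of y] dist_grid_corners(1)[OF n, of x y]
      dist_triangle[of x z "c x"] dist_triangle[of y z "c y"]
    unfolding *[symmetric] by (auto simp: c_def)
  then show "z \<in> cball x (dist x y + 12 / real n) \<union> cball y (dist x y + 12 / real n)" by auto
qed

lemma eventually_grid_pairs:
  assumes xy: "x \<noteq> y" "dist x y < s"
  shows "\<forall>\<^sub>F n in sequentially. (grid_index n x, grid_index n y) \<in> grid_pairs n s"
proof -
  have box: "\<forall>\<^sub>F n in sequentially. \<lfloor>real n * t\<rfloor> \<in> {- int (n * n)..int (n * n)}" for t :: real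
  proof -
    have "\<forall>\<^sub>F n in sequentially. \<bar>t\<bar> \<le> real n"
      using filterlim_real_sequentially by (auto simp: filterlim_at_top)
    then show ?thesis
    proof eventually_elim
      case (elim n)
      then have "- real n \<le> t" "t \<le> real n" by auto
      then have "real n * (- real n) \<le> real n * t" "real n * t \<le> real n * real n"
        by (intro mult_left_mono; simp)+
      then show ?case by (simp add: le_floor_iff floor_le_iff)
    qed
  qed
  have small: "\<forall>\<^sub>F n in sequentially. 8 / real n < \<epsilon>" if "\<epsilon> > 0" for \<epsilon> :: real
    using lim_const_over_n[of "8::real"] that by (auto simp: order_tendsto_iff)
  \<comment> \<open>The first bound separates the cells of x and y. The second pays for the rounding
    error 4/n and the margin 4/n in \<open>grid_pairs\<close>.\<close>
  have "\<forall>\<^sub>F n in sequentially. 8 / real n < dist x y" "\<forall>\<^sub>F n in sequentially. 8 / real n < s - dist x y"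
    using xy by (auto intro!: small)
  then show ?thesis
    using box[of "fst x"] box[of "snd x"] box[of "fst y"] box[of "snd y"] eventually_gt_at_top[of 0]
  proof eventually_elim
    case (elim n)
    have "grid_index n x \<noteq> grid_index n y"
      using dist_same_cell[of n x y] elim divide_right_mono[of 4 8 "real n"] by auto
    moreover have "dist (grid_corner n (grid_index n x)) (grid_corner n (grid_index n y)) + 4 / real n < s"
      using dist_grid_corners(1)[of n x y] elim by auto
    ultimately show ?case using elim by (simp add: grid_pairs_def Let_def grid_index_def)
  qed
qed

lemma grid_pairsD:
  assumes "n > 0" "(grid_index n x, grid_index n y) \<in> grid_pairs n s"
  shows "x \<noteq> y" "dist x y < s"
  using assms dist_grid_corners(2)[OF assms(1), of x y] by (auto simp: grid_pairs_def Let_def)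

section \<open>Detected cells against true pairs\<close>

text \<open>Detection is never wrong, whatever the mesh: any third point lies outside the zone,
  hence outside both closed discs of radius \<open>dist x y\<close>, which is exactly the strict
  inequality in \<open>nn_rel\<close>.\<close>

lemma detected_pairs_subset:
  assumes lf: "locally_finite \<phi>" and n: "n > 0"
  shows "detected_pairs n s \<phi> \<subseteq> map_prod (grid_index n) (grid_index n) ` mnnr_pairs s \<phi>"
proof
  fix p assume p: "p \<in> detected_pairs n s \<phi>"
  obtain i j where ij: "p = (i, j)" by (cases p)
  let ?W = "grid_zone n i j - (grid_cell n i \<inter> unit_square) - grid_cell n j"
  obtain x where x: "\<phi> \<inter> (grid_cell n i \<inter> unit_square) = {x}"
    using p by (auto simp: detected_pairs_def ij card_1_singleton_iff)
  obtain y where y: "\<phi> \<inter> grid_cell n j = {y}"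
    using p by (auto simp: detected_pairs_def ij card_1_singleton_iff)
  \<comment> \<open>\<open>card\<close> is 0 on infinite sets too, so finiteness has to be
    established before a zero count means emptiness.\<close>
  have "finite (\<phi> \<inter> ?W)"
    by (rule finite_subset[OF _ locally_finiteD[OF lf bounded_grid_zone]]) auto
  then have W: "\<phi> \<inter> ?W = {}"
    using p by (auto simp: detected_pairs_def ij)
  have xi: "x \<in> \<phi>" "x \<in> unit_square" "grid_index n x = i" using x by (auto simp: grid_cell_def)
  have yj: "y \<in> \<phi>" "grid_index n y = j" using y by (auto simp: grid_cell_def)
  have "(grid_index n x, grid_index n y) \<in> grid_pairs n s"
    using p xi yj by (simp add: detected_pairs_def ij)
  note xy = grid_pairsD[OF n this]
  have far: "dist x y < dist x z \<and> dist x y < dist y z" if z: "z \<in> \<phi> - {x, y}" for z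
  proof -
    have "z \<notin> grid_zone n i j" using z x y W by auto
    then show ?thesis using in_grid_zone[OF n, of x z y] xi yj by force
  qed
  then have "mnnr \<phi> x y"
    using xi yj xy by (auto simp: mnnr_def nn_rel_def dist_commute[of y x])
  then show "p \<in> map_prod (grid_index n) (grid_index n) ` mnnr_pairs s \<phi>"
    using xi yj xy by (auto simp: ij mnnr_pairs_def intro!: image_eqI[of _ _ "(x, y)"])
qed

text \<open>Local finiteness turns the strict inequalities into a uniform gap \<epsilon> between
  \<rho> and the distances from x and y to all other points. Once the rounding error is below the
  gap, the zone contains only x and y.\<close>

lemma eventually_detected:
  assumes lf: "locally_finite \<phi>" and xy: "(x, y) \<in> mnnr_pairs s \<phi>"
  shows "\<forall>\<^sub>F n in sequentially. (grid_index n x, grid_index n y) \<in> detected_pairs n s \<phi>"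
proof -
  have m: "mnnr \<phi> x y" and xU: "x \<in> unit_square" and s: "dist x y < s"
    using xy by (auto simp: mnnr_pairs_def)
  note mem = mnnr_mem[OF m]
  define \<rho> where "\<rho> = dist x y"
  have \<rho>: "\<rho> > 0" using mem by (simp add: \<rho>_def)
  define Z where "Z = \<phi> \<inter> (cball x (\<rho> + 1) \<union> cball y (\<rho> + 1)) - {x, y}"
  have Z: "finite Z" unfolding Z_def by (intro finite_Diff locally_finiteD[OF lf]) auto
  have near: "\<rho> < min (dist x z) (dist y z)" if "z \<in> Z" for z
    using that mnnr_dist_less[OF m, of z] mnnr_dist_less[OF mnnr_sym[OF m], of z]
    by (auto simp: Z_def \<rho>_def dist_commute)
  \<comment> \<open>The value 1 accounts for all points outside the discs of radius \<rho> + 1, and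
    keeps the set nonempty when Z is empty.\<close>
  define \<epsilon> where "\<epsilon> = Min (insert 1 ((\<lambda>z. min (dist x z) (dist y z) - \<rho>) ` Z))"
  have \<epsilon>: "\<epsilon> > 0" unfolding \<epsilon>_def using near Z by (subst Min_gr_iff) auto
  have gap: "\<rho> + \<epsilon> \<le> dist x z" "\<rho> + \<epsilon> \<le> dist y z" if z: "z \<in> \<phi>" "z \<noteq> x" "z \<noteq> y" for z
  proof -
    have "\<rho> + \<epsilon> \<le> min (dist x z) (dist y z)"
    proof (cases "z \<in> Z")
      case True
      then have "\<epsilon> \<le> min (dist x z) (dist y z) - \<rho>" unfolding \<epsilon>_def using Z by (intro Min_le) auto
      then show ?thesis by linarith
    next
      case False
      moreover have "\<epsilon> \<le> 1" unfolding \<epsilon>_def using Z by (intro Min_le) auto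
      ultimately show ?thesis using z by (auto simp: Z_def)
    qed
    then show "\<rho> + \<epsilon> \<le> dist x z" "\<rho> + \<epsilon> \<le> dist y z" by simp_all
  qed
  have "\<forall>\<^sub>F n in sequentially. 12 / real n < min \<rho> \<epsilon>"
    using lim_const_over_n[of "12::real"] \<rho> \<epsilon> unfolding order_tendsto_iff by (metis min_less_iff_conj)
  with eventually_grid_pairs[OF mem(3) s] eventually_gt_at_top[of 0] show ?thesis
  proof eventually_elim
    case (elim n)
    let ?i = "grid_index n x" and ?j = "grid_index n y"
    \<comment> \<open>The three bounds separate, in turn, x from y, each of them from third points
      in its cell, and the zone from third points.\<close>
    have n4: "4 / real n < \<rho>" "4 / real n < \<epsilon>" "12 / real n < \<epsilon>"
      using elim divide_right_mono[of 4 12 "real n"] by auto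
    have "z = x" if "z \<in> \<phi>" "grid_index n z = ?i" for z
      using dist_same_cell[of n x z] that gap(1)[of z] n4 elim \<rho> \<epsilon>
      by (cases "z = x"; cases "z = y") (auto simp: \<rho>_def)
    then have 1: "\<phi> \<inter> (grid_cell n ?i \<inter> unit_square) = {x}"
      using mem xU by (auto simp: grid_cell_def)
    have "z = y" if "z \<in> \<phi>" "grid_index n z = ?j" for z
      using dist_same_cell[of n y z] that gap(2)[of z] n4 elim \<rho> \<epsilon>
      by (cases "z = x"; cases "z = y") (auto simp: \<rho>_def dist_commute)
    then have 2: "\<phi> \<inter> grid_cell n ?j = {y}"
      using mem by (auto simp: grid_cell_def)
    have "z = x \<or> z = y" if z: "z \<in> \<phi>" "z \<in> grid_zone n ?i ?j" for z
    proof (rule ccontr)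
      assume "\<not> (z = x \<or> z = y)"
      then have "\<rho> + \<epsilon> \<le> dist x z" "\<rho> + \<epsilon> \<le> dist y z" using gap z by auto
      moreover have "dist x z \<le> \<rho> + 12 / real n \<or> dist y z \<le> \<rho> + 12 / real n"
        using grid_zone_subset[of n x y] elim z by (auto simp: \<rho>_def)
      ultimately show False using n4 by auto
    qed
    then have 3: "\<phi> \<inter> (grid_zone n ?i ?j - (grid_cell n ?i \<inter> unit_square) - grid_cell n ?j) = {}"
      using xU by (auto simp: grid_cell_def)
    show ?case unfolding detected_pairs_def using elim 1 2 3 by simp
  qed
qed

lemma inj_on_fst_mnnr_pairs: "inj_on fst (mnnr_pairs s \<phi>)"
  unfolding inj_on_def mnnr_pairs_def by clarsimp (metis mnnr_unique prod.inject)

lemma finite_mnnr_pairs: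
  assumes "locally_finite \<phi>"
  shows "finite (mnnr_pairs s \<phi>)"
proof (rule finite_imageD[OF _ inj_on_fst_mnnr_pairs])
  show "finite (fst ` mnnr_pairs s \<phi>)"
    by (rule finite_subset[OF _ locally_finiteD[OF assms bounded_unit_square]])
      (auto simp: mnnr_pairs_def dest: mnnr_mem)
qed

lemma card_detected_pairs_le:
  assumes "locally_finite \<phi>" "n > 0"
  shows "card (detected_pairs n s \<phi>) \<le> card (mnnr_pairs s \<phi>)"
  by (rule surj_card_le[OF finite_mnnr_pairs[OF assms(1)] detected_pairs_subset[OF assms]])

text \<open>There are finitely many pairs, so from some n on all are detected at once. The passage
  to cells is then injective, since a detected cell contributes only one point, and surjective by
  \<open>detected_pairs_subset\<close>.\<close>

lemma eventually_card_detected_pairs: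
  assumes lf: "locally_finite \<phi>"
  shows "\<forall>\<^sub>F n in sequentially. card (detected_pairs n s \<phi>) = card (mnnr_pairs s \<phi>)"
proof -
  have "\<forall>\<^sub>F n in sequentially. \<forall>p\<in>mnnr_pairs s \<phi>. map_prod (grid_index n) (grid_index n) p \<in> detected_pairs n s \<phi>"
    using eventually_detected[OF lf] finite_mnnr_pairs[OF lf]
    by (auto simp: eventually_ball_finite_distrib)
  then show ?thesis using eventually_gt_at_top[of 0]
  proof eventually_elim
    case (elim n)
    let ?q = "map_prod (grid_index n) (grid_index n)"
    have "?q ` mnnr_pairs s \<phi> = detected_pairs n s \<phi>"
      using elim detected_pairs_subset[OF lf, of n s] by (intro equalityI image_subsetI) auto
    moreover have "inj_on ?q (mnnr_pairs s \<phi>)"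
    proof (rule inj_onI, clarify)
      fix x y x' y'
      assume a: "(x, y) \<in> mnnr_pairs s \<phi>" "(x', y') \<in> mnnr_pairs s \<phi>" "?q (x, y) = ?q (x', y')"
      have "?q (x, y) \<in> detected_pairs n s \<phi>" using elim a by blast
      then obtain u v where uv: "\<phi> \<inter> (grid_cell n (grid_index n x) \<inter> unit_square) = {u}"
          "\<phi> \<inter> grid_cell n (grid_index n y) = {v}"
        by (auto simp: detected_pairs_def card_1_singleton_iff)
      have "x \<in> \<phi>" "y \<in> \<phi>" "x' \<in> \<phi>" "y' \<in> \<phi>" "x \<in> unit_square" "x' \<in> unit_square"
        using a by (auto simp: mnnr_pairs_def dest: mnnr_mem)
      then have "x \<in> {u}" "x' \<in> {u}" "y \<in> {v}" "y' \<in> {v}"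
        using a(3) unfolding uv[symmetric] by (simp_all add: grid_cell_def)
      then show "x = x' \<and> y = y'" by simp
    qed
    ultimately show ?case by (metis card_image)
  qed
qed

section \<open>Expected number of pairs\<close>

lemma poisson_process_two_singletons_void:
  assumes P: "poisson_process M lam \<Phi>"
    and A: "A \<in> sets borel" "bounded A" and B: "B \<in> sets borel" "bounded B"
    and C: "C \<in> sets borel" "bounded C"
    and disj: "A \<inter> B = {}" "A \<inter> C = {}" "B \<inter> C = {}"
  defines "E \<equiv> {\<omega> \<in> space M. card (\<Phi> \<omega> \<inter> A) = 1 \<and> card (\<Phi> \<omega> \<inter> B) = 1 \<and> card (\<Phi> \<omega> \<inter> C) = 0}"
  shows "E \<in> sets M"
    and "emeasure M E = ennreal (lam\<^sup>2 * measure lborel A * measure lborel B *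
      exp (- lam * (measure lborel A + measure lborel B + measure lborel C)))"
proof -
  interpret prob_space M using P by (simp add: poisson_process_def)
  \<comment> \<open>The sets are numbered 0, 1, 2 to match the indexed form of independence in
    \<open>poisson_process\<close>.\<close>
  define S where "S = (\<lambda>i::nat. if i = 0 then A else if i = 1 then B else C)"
  define K where "K = (\<lambda>i::nat. if i = 2 then {0::nat} else {1})"
  define X where "X = (\<lambda>i \<omega>. card (\<Phi> \<omega> \<inter> S i))"
  have S: "S i \<in> sets lborel \<and> bounded (S i)" for i using A B C by (simp add: S_def)
  have "disjoint_family_on S {0, 1, 2}"
    using disj by (auto simp: disjoint_family_on_def S_def)
  then have indep: "indep_vars (\<lambda>_. count_space UNIV) X {0, 1, 2}"
    using P[unfolded poisson_process_def, THEN conjunct2, THEN conjunct2, THEN conjunct2, rule_format,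
        of "{0, 1, 2}" S] S by (simp add: X_def)
  note count = P[unfolded poisson_process_def, THEN conjunct2, THEN conjunct2, THEN conjunct1, rule_format]
  have [measurable]: "X i \<in> M \<rightarrow>\<^sub>M count_space UNIV" for i
    using count[of "S i"] S[of i] by (simp add: X_def)
  have pr: "prob (X i -` {k} \<inter> space M)
      = (lam * measure lborel (S i)) ^ k / fact k * exp (- (lam * measure lborel (S i)))" for i k
  proof -
    have "X i -` {k} \<inter> space M = {\<omega> \<in> space M. card (\<Phi> \<omega> \<inter> S i) = k}" by (auto simp: X_def)
    then show ?thesis using count[of "S i"] S[of i] by simp
  qed
  have E: "E = (\<Inter>i\<in>{0, 1, 2}. X i -` K i \<inter> space M)"
    by (auto simp: E_def X_def S_def K_def)
  show "E \<in> sets M" unfolding E by measurable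
  have "prob E = (\<Prod>i\<in>{0, 1, 2}. prob (X i -` K i \<inter> space M))"
    unfolding E by (rule indep_varsD_finite[OF indep]) auto
  also have "\<dots> = (lam * measure lborel A * exp (- (lam * measure lborel A))) *
      ((lam * measure lborel B * exp (- (lam * measure lborel B))) * exp (- (lam * measure lborel C)))"
    by (simp add: K_def pr) (simp add: S_def)
  also have "\<dots> = lam\<^sup>2 * measure lborel A * measure lborel B *
      exp (- lam * (measure lborel A + measure lborel B + measure lborel C))"
    by (simp add: power2_eq_square algebra_simps exp_add[symmetric] exp_diff exp_minus field_simps)
  finally show "emeasure M E = ennreal (lam\<^sup>2 * measure lborel A * measure lborel B *
      exp (- lam * (measure lborel A + measure lborel B + measure lborel C)))"
    by (simp add: emeasure_eq_measure)
qed

text \<open>The two cells and the void region partition the zone, so the three exponents add up to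
  its area. The cell areas remain separate factors in order to become a product measure
  below.\<close>

lemma detected_pairs_prob:
  assumes P: "poisson_process M lam \<Phi>" and n: "n > 0" and ij: "(i, j) \<in> grid_pairs n s"
  shows "{\<omega> \<in> space M. (i, j) \<in> detected_pairs n s (\<Phi> \<omega>)} \<in> sets M"
    and "emeasure M {\<omega> \<in> space M. (i, j) \<in> detected_pairs n s (\<Phi> \<omega>)} =
      ennreal (lam\<^sup>2 * exp (- lam * measure lborel (grid_zone n i j))) *
      (emeasure lborel (grid_cell n i \<inter> unit_square) * emeasure lborel (grid_cell n j))"
proof -
  let ?A = "grid_cell n i \<inter> unit_square" and ?B = "grid_cell n j"
  let ?W = "grid_zone n i j - ?A - ?B"
  have bd: "bounded ?A" "bounded ?B" "bounded ?W"
    using bounded_grid_cell[OF n, of i] bounded_grid_cell[OF n, of j] bounded_grid_zone[of n i j]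
    by (auto intro: bounded_subset)
  have AB: "?A \<inter> ?B = {}" using ij by (auto simp: grid_pairs_def Let_def grid_cell_def)
  have fm: "?A \<in> fmeasurable lborel" "?B \<in> fmeasurable lborel" "?W \<in> fmeasurable lborel"
    using bd by (auto intro!: fmeasurableI emeasure_bounded_finite)
  have "measure lborel (grid_zone n i j) = measure lborel (?A \<union> ?B \<union> ?W)"
    using grid_cells_subset_zone[OF n, of i j] by (intro arg_cong[where f = "measure lborel"]) auto
  also have "\<dots> = measure lborel (?A \<union> ?B) + measure lborel ?W"
    using fm by (intro measure_Un_AE fmeasurable.Un) auto
  also have "measure lborel (?A \<union> ?B) = measure lborel ?A + measure lborel ?B"
    using fm AB by (intro measure_Un_AE) auto
  finally have zone: "measure lborel ?A + measure lborel ?B + measure lborel ?W = measure lborel (grid_zone n i j)"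
    by simp
  have eq: "{\<omega> \<in> space M. (i, j) \<in> detected_pairs n s (\<Phi> \<omega>)}
    = {\<omega> \<in> space M. card (\<Phi> \<omega> \<inter> ?A) = 1 \<and> card (\<Phi> \<omega> \<inter> ?B) = 1 \<and> card (\<Phi> \<omega> \<inter> ?W) = 0}"
    using ij unfolding detected_pairs_def by simp
  have meas: "?A \<in> sets borel" "?B \<in> sets borel" "?W \<in> sets borel" by measurable
  note * = poisson_process_two_singletons_void[OF P meas(1) bd(1) meas(2) bd(2) meas(3) bd(3) AB]
  show "{\<omega> \<in> space M. (i, j) \<in> detected_pairs n s (\<Phi> \<omega>)} \<in> sets M"
    unfolding eq by (rule *) auto
  have "emeasure M {\<omega> \<in> space M. (i, j) \<in> detected_pairs n s (\<Phi> \<omega>)}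
    = ennreal (lam\<^sup>2 * measure lborel ?A * measure lborel ?B * exp (- lam * measure lborel (grid_zone n i j)))"
    unfolding eq zone[symmetric] by (rule *) auto
  also have "\<dots> = ennreal (lam\<^sup>2 * exp (- lam * measure lborel (grid_zone n i j))) *
      (ennreal (measure lborel ?A) * ennreal (measure lborel ?B))"
    by (simp add: ennreal_mult'[symmetric] mult_ac)
  finally show "emeasure M {\<omega> \<in> space M. (i, j) \<in> detected_pairs n s (\<Phi> \<omega>)} =
      ennreal (lam\<^sup>2 * exp (- lam * measure lborel (grid_zone n i j))) *
      (emeasure lborel ?A * emeasure lborel ?B)"
    using fm by (simp add: emeasure_eq_measure2 fmeasurableD2)
qed

text \<open>A step function on pairs of points whose integral is the expected number of detected
  pairs.\<close>

definition grid_kernel :: "real \<Rightarrow> real \<Rightarrow> nat \<Rightarrow> pt \<times> pt \<Rightarrow> ennreal" where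
  "grid_kernel lam s n = (\<lambda>(x, y). \<Sum>(i, j)\<in>grid_pairs n s.
     ennreal (lam\<^sup>2 * exp (- lam * measure lborel (grid_zone n i j))) *
     indicator ((grid_cell n i \<inter> unit_square) \<times> grid_cell n j) (x, y))"

text \<open>The density that a Mecke formula would give: \<lambda>^2 times the probability that the
  union of the two discs is void. It is set to 0 on the diagonal, where the step functions vanish as
  well.\<close>

definition mnnr_kernel :: "real \<Rightarrow> real \<Rightarrow> pt \<times> pt \<Rightarrow> ennreal" where
  "mnnr_kernel lam s = (\<lambda>(x, y). if x \<in> unit_square \<and> x \<noteq> y \<and> dist x y < s
     then ennreal (lam\<^sup>2 * exp (- lam * ((4 * pi / 3 + sqrt 3 / 2) * (dist x y)\<^sup>2))) else 0)"

lemma card_detected_pairs_eq_sum: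
  "ennreal (card (detected_pairs n s \<phi>)) = (\<Sum>p\<in>grid_pairs n s. indicator (detected_pairs n s \<phi>) p)"
proof -
  have "detected_pairs n s \<phi> = {p \<in> grid_pairs n s. p \<in> detected_pairs n s \<phi>}"
    by (auto simp: detected_pairs_def)
  then show ?thesis
    by (simp add: indicator_def sum.If_cases Int_def ennreal_of_nat_eq_real_of_nat flip: of_nat_sum)
qed

text \<open>By linearity over the finitely many cell pairs; each product of two cell areas is the
  integral of the indicator of a rectangle.\<close>

lemma expectation_card_detected_pairs:
  assumes P: "poisson_process M lam \<Phi>" and n: "n > 0"
  shows "(\<lambda>\<omega>. ennreal (card (detected_pairs n s (\<Phi> \<omega>)))) \<in> borel_measurable M"
    and "(\<integral>\<^sup>+ \<omega>. ennreal (card (detected_pairs n s (\<Phi> \<omega>))) \<partial>M) = (\<integral>\<^sup>+ z. grid_kernel lam s n z \<partial>lborel)"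
proof -
  define D where "D p = {\<omega> \<in> space M. p \<in> detected_pairs n s (\<Phi> \<omega>)}" for p
  have D: "D p \<in> sets M" if "p \<in> grid_pairs n s" for p
    using detected_pairs_prob(1)[OF P n] that by (cases p) (auto simp: D_def)
  have eq: "ennreal (card (detected_pairs n s (\<Phi> \<omega>))) = (\<Sum>p\<in>grid_pairs n s. indicator (D p) \<omega>)"
    if "\<omega> \<in> space M" for \<omega>
    unfolding card_detected_pairs_eq_sum using that by (intro sum.cong) (auto simp: D_def indicator_def)
  show "(\<lambda>\<omega>. ennreal (card (detected_pairs n s (\<Phi> \<omega>)))) \<in> borel_measurable M"
    using D by (subst measurable_cong[OF eq]) (auto intro!: borel_measurable_sum borel_measurable_indicator)
  have "(\<integral>\<^sup>+ \<omega>. ennreal (card (detected_pairs n s (\<Phi> \<omega>))) \<partial>M)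
     = (\<integral>\<^sup>+ \<omega>. (\<Sum>p\<in>grid_pairs n s. indicator (D p) \<omega>) \<partial>M)"
    by (rule nn_integral_cong) (rule eq)
  also have "\<dots> = (\<Sum>p\<in>grid_pairs n s. emeasure M (D p))"
    using D by (subst nn_integral_sum) (auto intro!: sum.cong)
  also have "\<dots> = (\<Sum>(i, j)\<in>grid_pairs n s. ennreal (lam\<^sup>2 * exp (- lam * measure lborel (grid_zone n i j))) *
      (emeasure lborel (grid_cell n i \<inter> unit_square) * emeasure lborel (grid_cell n j)))"
    using detected_pairs_prob(2)[OF P n] by (intro sum.cong) (auto simp: D_def)
  also have "\<dots> = (\<Sum>(i, j)\<in>grid_pairs n s. \<integral>\<^sup>+ z. ennreal (lam\<^sup>2 * exp (- lam * measure lborel (grid_zone n i j))) *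
      indicator ((grid_cell n i \<inter> unit_square) \<times> grid_cell n j) z \<partial>(lborel \<Otimes>\<^sub>M lborel))"
    by (intro sum.cong refl) (auto simp: nn_integral_cmult_indicator lborel.emeasure_pair_measure_Times)
  also have "\<dots> = (\<integral>\<^sup>+ z. grid_kernel lam s n z \<partial>(lborel \<Otimes>\<^sub>M lborel))"
    unfolding grid_kernel_def case_prod_unfold prod.collapse
    by (subst nn_integral_sum) (auto intro!: borel_measurable_times_ennreal borel_measurable_indicator pair_measureI)
  finally show "(\<integral>\<^sup>+ \<omega>. ennreal (card (detected_pairs n s (\<Phi> \<omega>))) \<partial>M) = (\<integral>\<^sup>+ z. grid_kernel lam s n z \<partial>lborel)"
    by (simp add: lborel_prod)
qed

section \<open>Limit of the kernels and its integral\<close>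

text \<open>The cells are disjoint, so at most one term of the sum survives at a given
  point.\<close>

lemma grid_kernel_eq:
  "grid_kernel lam s n (x, y) = (if x \<in> unit_square \<and> (grid_index n x, grid_index n y) \<in> grid_pairs n s
     then ennreal (lam\<^sup>2 * exp (- lam * measure lborel (grid_zone n (grid_index n x) (grid_index n y)))) else 0)"
proof -
  have "grid_kernel lam s n (x, y) = (\<Sum>p\<in>grid_pairs n s. if (grid_index n x, grid_index n y) = p then
     (if x \<in> unit_square then ennreal (lam\<^sup>2 * exp (- lam * measure lborel (grid_zone n (fst p) (snd p)))) else 0) else 0)"
    unfolding grid_kernel_def prod.case
    by (intro sum.cong refl) (auto simp: indicator_def grid_cell_def split: prod.splits)
  then show ?thesis by (simp add: sum.delta')
qed

text \<open>The zone contains the two discs and is contained in their enlargements by 12/n. The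
  excess is covered by two annuli whose areas tend to 0.\<close>

lemma measure_grid_zone_tendsto:
  "(\<lambda>n. measure lborel (grid_zone n (grid_index n x) (grid_index n y)))
     \<longlonglongrightarrow> (4 * pi / 3 + sqrt 3 / 2) * (dist x y)\<^sup>2"
proof (rule tendsto_sandwich)
  define \<rho> where "\<rho> = dist x y"
  let ?\<kappa> = "4 * pi / 3 + sqrt 3 / 2"
  have disc: "measure lborel (cball z t) = pi * t\<^sup>2" if "t \<ge> 0" for z :: pt and t
    using that by (simp add: content_cball unit_ball_vol_2 power2_eq_square)
  have fm: "cball z t \<in> fmeasurable lborel" for z :: pt and t
    by (auto intro!: fmeasurableI emeasure_bounded_finite)
  have zone: "grid_zone n i j \<in> fmeasurable lborel" for n i j
    using bounded_grid_zone[of n i j] grid_zone_borel[of n i j]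
    by (intro fmeasurableI emeasure_bounded_finite) simp_all
  show "\<forall>\<^sub>F n in sequentially. ?\<kappa> * (dist x y)\<^sup>2 \<le> measure lborel (grid_zone n (grid_index n x) (grid_index n y))"
    using eventually_gt_at_top[of 0]
  proof eventually_elim
    case (elim n)
    show ?case unfolding measure_two_discs[symmetric]
      using in_grid_zone[OF elim, of x _ y] zone by (intro measure_mono_fmeasurable) auto
  qed
  show "\<forall>\<^sub>F n in sequentially. measure lborel (grid_zone n (grid_index n x) (grid_index n y))
     \<le> ?\<kappa> * (dist x y)\<^sup>2 + 2 * pi * ((dist x y + 12 / real n)\<^sup>2 - (dist x y)\<^sup>2)"
    using eventually_gt_at_top[of 0]
  proof eventually_elim
    case (elim n)
    define t where "t = \<rho> + 12 / real n"
    have t: "0 \<le> \<rho>" "\<rho> \<le> t" by (auto simp: t_def \<rho>_def)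
    have diff: "measure lborel (cball z t - cball z \<rho>) = pi * t\<^sup>2 - pi * \<rho>\<^sup>2" for z :: pt
      using t fm by (subst measure_Diff) (auto simp: disc fmeasurableD2 cball_subset_cball_iff)
    let ?D = "cball x \<rho> \<union> cball y \<rho>" and ?X = "cball x t - cball x \<rho>" and ?Y = "cball y t - cball y \<rho>"
    have "measure lborel (grid_zone n (grid_index n x) (grid_index n y)) \<le> measure lborel (?D \<union> (?X \<union> ?Y))"
      using grid_zone_subset[OF elim, of x y] fm
      by (intro measure_mono_fmeasurable fmeasurable.Un fmeasurable.Diff) (auto simp: t_def \<rho>_def)
    also have "\<dots> \<le> measure lborel ?D + measure lborel (?X \<union> ?Y)"
      using fm by (intro measure_Un_le) auto
    also have "measure lborel (?X \<union> ?Y) \<le> measure lborel ?X + measure lborel ?Y"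
      using fm by (intro measure_Un_le) auto
    also have "measure lborel ?D = ?\<kappa> * \<rho>\<^sup>2" unfolding \<rho>_def by (rule measure_two_discs)
    finally show ?case unfolding diff by (simp add: t_def \<rho>_def algebra_simps)
  qed
  have "(\<lambda>n. ?\<kappa> * (dist x y)\<^sup>2 + 2 * pi * ((dist x y + 12 / real n)\<^sup>2 - (dist x y)\<^sup>2))
    \<longlonglongrightarrow> ?\<kappa> * (dist x y)\<^sup>2 + 2 * pi * ((dist x y + 0)\<^sup>2 - (dist x y)\<^sup>2)"
    by (intro tendsto_intros lim_const_over_n)
  then show "(\<lambda>n. ?\<kappa> * (dist x y)\<^sup>2 + 2 * pi * ((dist x y + 12 / real n)\<^sup>2 - (dist x y)\<^sup>2))
    \<longlonglongrightarrow> ?\<kappa> * (dist x y)\<^sup>2" by simp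
qed simp

text \<open>Convergence holds at every point: outside the support of the limit the step functions
  vanish for all positive n, because of the margin in \<open>grid_pairs\<close>. Measurability of
  the limit follows from it.\<close>

lemma grid_kernel_tendsto: "(\<lambda>n. grid_kernel lam s n z) \<longlonglongrightarrow> mnnr_kernel lam s z"
proof -
  obtain x y where Pair: "z = (x, y)" by (cases z)
  show ?thesis
  proof (cases "x \<in> unit_square \<and> x \<noteq> y \<and> dist x y < s")
    case True
    have "(\<lambda>n. ennreal (lam\<^sup>2 * exp (- lam * measure lborel (grid_zone n (grid_index n x) (grid_index n y)))))
       \<longlonglongrightarrow> ennreal (lam\<^sup>2 * exp (- lam * ((4 * pi / 3 + sqrt 3 / 2) * (dist x y)\<^sup>2)))"
      by (intro tendsto_intros measure_grid_zone_tendsto)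
    moreover have "\<forall>\<^sub>F n in sequentially. (grid_index n x, grid_index n y) \<in> grid_pairs n s"
      using eventually_grid_pairs[of x y s] True by simp
    then have "\<forall>\<^sub>F n in sequentially. grid_kernel lam s n z
       = ennreal (lam\<^sup>2 * exp (- lam * measure lborel (grid_zone n (grid_index n x) (grid_index n y))))"
      by eventually_elim (use True in \<open>simp add: Pair grid_kernel_eq\<close>)
    ultimately show ?thesis
      using True by (simp add: Pair mnnr_kernel_def tendsto_cong)
  next
    case False
    have "\<forall>\<^sub>F n in sequentially. grid_kernel lam s n z = 0"
      using eventually_gt_at_top[of 0]
      by eventually_elim (use False grid_pairsD[of _ x y s] in \<open>auto simp: Pair grid_kernel_eq\<close>)
    then show ?thesis
      using False by (auto simp: Pair mnnr_kernel_def intro: tendsto_eventually)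
  qed
qed

lemma grid_kernel_measurable [measurable]: "grid_kernel lam s n \<in> borel_measurable borel"
  unfolding grid_kernel_def case_prod_unfold prod.collapse
  by (intro borel_measurable_sum borel_measurable_times_ennreal borel_measurable_indicator
      borel_measurable_const borel_Times sets.Int grid_cell_borel unit_square_borel)

lemma mnnr_kernel_measurable [measurable]: "mnnr_kernel lam s \<in> borel_measurable borel"
  by (rule borel_measurable_LIMSEQ_order[OF grid_kernel_tendsto grid_kernel_measurable])

text \<open>For fixed x, translating by x leaves the radial integral with b = \<lambda> \<kappa>;
  the diagonal becomes the null set h = 0, and the unit square contributes a factor 1.\<close>

lemma nn_integral_mnnr_kernel:
  assumes "lam > 0" "s \<ge> 0"
  defines "\<kappa> \<equiv> 4 * pi / 3 + sqrt 3 / 2"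
  shows "(\<integral>\<^sup>+ z. mnnr_kernel lam s z \<partial>lborel) = ennreal (lam * pi / \<kappa> * (1 - exp (- lam * \<kappa> * s\<^sup>2)))"
proof -
  have \<kappa>: "\<kappa> > 0" unfolding \<kappa>_def by (simp add: add_pos_nonneg)
  have kernel: "mnnr_kernel lam s (x, y) = (if x \<in> unit_square \<and> x \<noteq> y \<and> dist x y < s
     then ennreal (lam\<^sup>2 * exp (- lam * (\<kappa> * (dist x y)\<^sup>2))) else 0)" for x y
    by (simp only: mnnr_kernel_def prod.case \<kappa>_def)
  define I where "I = ennreal (lam * pi / \<kappa> * (1 - exp (- lam * \<kappa> * s\<^sup>2)))"
  have inner: "(\<integral>\<^sup>+ y. mnnr_kernel lam s (x, y) \<partial>lborel) = I * indicator unit_square x" for x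
  proof (cases "x \<in> unit_square")
    case True
    let ?g = "\<lambda>h::pt. indicator (ball 0 s) h * ennreal (exp (- (lam * \<kappa>) * (norm h)\<^sup>2))"
    have g: "?g \<in> borel_measurable borel"
      by (intro borel_measurable_times_ennreal borel_measurable_indicator) measurable
    have "(\<integral>\<^sup>+ y. mnnr_kernel lam s (x, y) \<partial>lborel) = (\<integral>\<^sup>+ y. mnnr_kernel lam s (x, y) \<partial>distr lborel borel ((+) x))"
      by (simp add: lborel_distr_plus)
    also have "\<dots> = (\<integral>\<^sup>+ h. mnnr_kernel lam s (x, x + h) \<partial>lborel)"
      by (subst nn_integral_distr) (auto intro!: measurable_compose[OF _ mnnr_kernel_measurable]
          borel_measurable_continuous_onI continuous_intros)
    also have "\<dots> = (\<integral>\<^sup>+ h. ennreal (lam\<^sup>2) * ?g h \<partial>lborel)"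
      using AE_lborel_singleton[of "0::pt"]
      by (intro nn_integral_cong_AE, eventually_elim)
        (use True in \<open>auto simp: kernel dist_norm
          ennreal_mult'[symmetric] mult_ac indicator_def\<close>)
    also have "\<dots> = ennreal (lam\<^sup>2) * ennreal (pi / (lam * \<kappa>) * (1 - exp (- (lam * \<kappa>) * s\<^sup>2)))"
      using g nn_integral_radial_exp[of "lam * \<kappa>" s] assms(1,2) \<kappa> by (subst nn_integral_cmult) simp_all
    also have "\<dots> = I"
      using assms(1) \<kappa> unfolding I_def
      by (simp add: ennreal_mult'[symmetric]) (simp add: power2_eq_square field_simps)
    finally show ?thesis using True by simp
  qed (simp add: mnnr_kernel_def)
  have "(\<integral>\<^sup>+ z. mnnr_kernel lam s z \<partial>lborel) = (\<integral>\<^sup>+ x. (\<integral>\<^sup>+ y. mnnr_kernel lam s (x, y) \<partial>lborel) \<partial>lborel)"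
    using lborel.nn_integral_fst[of "mnnr_kernel lam s" lborel] by (simp add: lborel_prod)
  also have "\<dots> = I"
    unfolding inner by (simp add: nn_integral_cmult_indicator emeasure_unit_square)
  finally show ?thesis unfolding I_def .
qed

text \<open>Dominated convergence with the bound \<lambda>^2 on a bounded set: both points lie in
  the unit square or within s of it. Using \<open>Suc n\<close> skips the degenerate grid n =
  0.\<close>

lemma nn_integral_grid_kernel_tendsto:
  assumes "lam > 0"
  shows "(\<lambda>n. \<integral>\<^sup>+ z. grid_kernel lam s (Suc n) z \<partial>lborel) \<longlonglongrightarrow> (\<integral>\<^sup>+ z. mnnr_kernel lam s z \<partial>lborel)"
proof (rule nn_integral_dominated_convergence)
  let ?B = "unit_square \<times> (\<Union>x\<in>unit_square. ball x s)"
  let ?w = "\<lambda>z. ennreal (lam\<^sup>2) * indicator ?B z"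
  have B: "?B \<in> sets borel"
    by (intro borel_Times unit_square_borel borel_open open_UN) simp
  have "bounded ?B"
  proof (intro bounded_Times bounded_unit_square)
    obtain R where R: "\<And>x. x \<in> unit_square \<Longrightarrow> norm x \<le> R"
      using bounded_unit_square unfolding bounded_iff by blast
    have "norm y \<le> R + s" if "x \<in> unit_square" "dist x y < s" for x y
      using R[OF that(1)] that(2) norm_triangle_ineq2[of y x] by (simp add: dist_norm norm_minus_commute)
    then show "bounded (\<Union>x\<in>unit_square. ball x s)"
      unfolding bounded_iff by (intro exI[of _ "R + s"]) auto
  qed
  from emeasure_bounded_finite[OF this] show "(\<integral>\<^sup>+ z. ?w z \<partial>lborel) < \<infinity>"
    using B by (subst nn_integral_cmult_indicator) (auto simp: ennreal_mult_less_top)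
  show "?w \<in> borel_measurable lborel" using B by simp
  show "AE z in lborel. grid_kernel lam s (Suc n) z \<le> ?w z" for n
  proof (rule AE_I2)
    fix z :: "pt \<times> pt"
    obtain x y where z: "z = (x, y)" by (cases z)
    have "exp (- lam * measure lborel C) \<le> 1" for C :: "pt set" using assms by simp
    then have "lam\<^sup>2 * exp (- lam * measure lborel C) \<le> lam\<^sup>2" for C :: "pt set"
      by (metis mult.right_neutral mult_left_mono zero_le_power2)
    then show "grid_kernel lam s (Suc n) z \<le> ?w z"
      using grid_pairsD(2)[of "Suc n" x y s] by (auto simp: z grid_kernel_eq indicator_def ennreal_leI)
  qed
  show "AE z in lborel. (\<lambda>n. grid_kernel lam s (Suc n) z) \<longlonglongrightarrow> mnnr_kernel lam s z"
    using LIMSEQ_Suc[OF grid_kernel_tendsto] by simp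
qed simp_all

section \<open>Passage to the limit in the expectation\<close>

text \<open>Fatou gives one inequality, domination by the limit the other. It stands in for monotone
  convergence, as the grid counts need not increase with n.\<close>

lemma nn_integral_eq_lim_below:
  fixes u :: "nat \<Rightarrow> 'a \<Rightarrow> ennreal"
  assumes u: "\<And>n. u n \<in> borel_measurable M"
    and le: "\<And>n x. x \<in> space M \<Longrightarrow> u n x \<le> f x"
    and lim: "\<And>x. x \<in> space M \<Longrightarrow> (\<lambda>n. u n x) \<longlonglongrightarrow> f x"
    and int: "(\<lambda>n. \<integral>\<^sup>+ x. u n x \<partial>M) \<longlonglongrightarrow> I"
  shows "(\<integral>\<^sup>+ x. f x \<partial>M) = I"
proof (rule antisym)
  have "(\<integral>\<^sup>+ x. f x \<partial>M) = (\<integral>\<^sup>+ x. liminf (\<lambda>n. u n x) \<partial>M)"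
    using lim by (intro nn_integral_cong) (metis lim_imp_Liminf sequentially_bot)
  also have "\<dots> \<le> liminf (\<lambda>n. \<integral>\<^sup>+ x. u n x \<partial>M)"
    by (rule nn_integral_liminf) (rule u)
  also have "\<dots> = I" by (rule lim_imp_Liminf[OF sequentially_bot int])
  finally show "(\<integral>\<^sup>+ x. f x \<partial>M) \<le> I" .
  have "(\<integral>\<^sup>+ x. u n x \<partial>M) \<le> (\<integral>\<^sup>+ x. f x \<partial>M)" for n
    using le by (rule nn_integral_mono)
  then show "I \<le> (\<integral>\<^sup>+ x. f x \<partial>M)"
    by (intro LIMSEQ_le_const2[OF int]) auto
qed

lemma expectation_card_mnnr_pairs:
  assumes P: "poisson_process M lam \<Phi>" and lam: "lam > 0" and s: "s \<ge> 0"
  defines "\<kappa> \<equiv> 4 * pi / 3 + sqrt 3 / 2"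
  shows "(\<lambda>\<omega>. ennreal (card (mnnr_pairs s (\<Phi> \<omega>)))) \<in> borel_measurable M"
    and "(\<integral>\<^sup>+ \<omega>. ennreal (card (mnnr_pairs s (\<Phi> \<omega>))) \<partial>M)
      = ennreal (lam * pi / \<kappa> * (1 - exp (- lam * \<kappa> * s\<^sup>2)))"
proof -
  let ?N = "\<lambda>\<omega>. ennreal (card (mnnr_pairs s (\<Phi> \<omega>)))"
  let ?D = "\<lambda>n \<omega>. ennreal (card (detected_pairs (Suc n) s (\<Phi> \<omega>)))"
  let ?I = "ennreal (lam * pi / \<kappa> * (1 - exp (- lam * \<kappa> * s\<^sup>2)))"
  have lf: "locally_finite (\<Phi> \<omega>)" if "\<omega> \<in> space M" for \<omega>
    using P that by (simp add: poisson_process_def)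
  have D [measurable]: "?D n \<in> borel_measurable M" for n
    using expectation_card_detected_pairs(1)[OF P] by simp
  have lim: "(\<lambda>n. ?D n \<omega>) \<longlonglongrightarrow> ?N \<omega>" if "\<omega> \<in> space M" for \<omega>
    using eventually_card_detected_pairs[OF lf[OF that], of s]
    by (intro LIMSEQ_Suc[of "\<lambda>n. ennreal (card (detected_pairs n s (\<Phi> \<omega>)))"] tendsto_eventually)
      (auto elim: eventually_mono)
  show "?N \<in> borel_measurable M"
    by (rule borel_measurable_LIMSEQ_order[OF lim D])
  have int: "(\<lambda>n. \<integral>\<^sup>+ \<omega>. ?D n \<omega> \<partial>M) \<longlonglongrightarrow> ?I"
    using nn_integral_grid_kernel_tendsto[OF lam, of s]
    by (simp add: expectation_card_detected_pairs(2)[OF P] nn_integral_mnnr_kernel[OF lam s] \<kappa>_def)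
  show "(\<integral>\<^sup>+ \<omega>. ?N \<omega> \<partial>M) = ?I"
    using D _ lim int
  proof (rule nn_integral_eq_lim_below)
    show "?D n \<omega> \<le> ?N \<omega>" if "\<omega> \<in> space M" for n \<omega>
      using card_detected_pairs_le[OF lf[OF that], of "Suc n"] by (intro ennreal_leI) simp
  qed
qed

lemma card_mnnr_pairs:
  "card (mnnr_pairs s \<phi>) = card {x \<in> unit_square. \<exists>y. mnnr \<phi> x y \<and> dist x y < s}"
proof -
  have "fst ` mnnr_pairs s \<phi> = {x \<in> unit_square. \<exists>y. mnnr \<phi> x y \<and> dist x y < s}"
    unfolding mnnr_pairs_def by force
  then show ?thesis using card_image[OF inj_on_fst_mnnr_pairs, of s \<phi>] by simp
qed

section \<open>Nearest neighbour distribution of the thinning\<close>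

theorem theorem2:
  fixes M :: "'w measure" and lam :: real and \<Phi> :: "'w \<Rightarrow> pt set" and r :: real
  assumes "lam > 0"
    and "poisson_process M lam \<Phi>"
    and "r \<ge> 0"
  shows "nn_distribution M (\<lambda>\<omega>. mnnr_thinning (\<Phi> \<omega>)) r
           = 1 - exp (- lam * pi * r\<^sup>2 * (2 - (2/3 - sqrt 3 / (2 * pi))))"
proof -
  define \<kappa> where "\<kappa> = 4 * pi / 3 + sqrt 3 / 2"
  have \<kappa>: "\<kappa> > 0" unfolding \<kappa>_def by (simp add: add_pos_nonneg)
  define F where "F s = lam * pi / \<kappa> * (1 - exp (- lam * \<kappa> * s\<^sup>2))" for s
  have mble: "(\<lambda>\<omega>. ennreal (card (mnnr_pairs s (\<Phi> \<omega>)))) \<in> borel_measurable M"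
    and expect: "(\<integral>\<^sup>+ \<omega>. ennreal (card (mnnr_pairs s (\<Phi> \<omega>))) \<partial>M) = ennreal (F s)" if "s \<ge> 0" for s
    using expectation_card_mnnr_pairs[OF assms(2,1) that] by (simp_all add: F_def \<kappa>_def)
  have F0: "F s \<ge> 0" for s using assms(1) \<kappa> by (simp add: F_def)
  have fin: "finite {x \<in> unit_square. \<exists>y. mnnr (\<Phi> \<omega>) x y \<and> Q x y}" if "\<omega> \<in> space M" for \<omega> Q
  proof (rule finite_subset)
    show "finite (\<Phi> \<omega> \<inter> unit_square)"
      using assms(2) that by (intro locally_finiteD) (simp_all add: poisson_process_def)
    show "{x \<in> unit_square. \<exists>y. mnnr (\<Phi> \<omega>) x y \<and> Q x y} \<subseteq> \<Phi> \<omega> \<inter> unit_square"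
      using mnnr_mem(1) by blast
  qed

  \<comment> \<open>Letting s run through the integers to infinity removes the distance restriction;
    the limit is the intensity of the thinning.\<close>
  have den: "(\<integral>\<^sup>+ \<omega>. ennreal (card (mnnr_thinning (\<Phi> \<omega>) \<inter> unit_square)) \<partial>M) = ennreal (lam * pi / \<kappa>)"
  proof (rule nn_integral_eq_lim_below[where u = "\<lambda>n \<omega>. ennreal (card (mnnr_pairs (real n) (\<Phi> \<omega>)))"])
    fix \<omega> assume \<omega>: "\<omega> \<in> space M"
    let ?T = "mnnr_thinning (\<Phi> \<omega>) \<inter> unit_square"
    let ?S = "\<lambda>n::nat. {x \<in> unit_square. \<exists>y. mnnr (\<Phi> \<omega>) x y \<and> dist x y < real n}"
    \<comment> \<open>The conjunct \<open>True\<close> gives the set the shape expected by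
      \<open>fin\<close>.\<close>
    have T: "?T = {x \<in> unit_square. \<exists>y. mnnr (\<Phi> \<omega>) x y \<and> True}"
      by (rule set_eqI) (simp only: Int_iff mem_Collect_eq mnnr_thinning_iff simp_thms conj_commute)
    have finT: "finite ?T" unfolding T by (rule fin[OF \<omega>])
    have sub: "?S n \<subseteq> ?T" for n unfolding T by blast
    show "ennreal (card (mnnr_pairs (real n) (\<Phi> \<omega>))) \<le> ennreal (card ?T)" for n
      unfolding card_mnnr_pairs using card_mono[OF finT sub] by (intro ennreal_leI) simp
    have "\<forall>\<^sub>F n in sequentially. x \<in> ?S n" if x: "x \<in> ?T" for x
    proof -
      obtain y where y: "mnnr (\<Phi> \<omega>) x y" "x \<in> unit_square" using x unfolding T by blast
      have "\<forall>\<^sub>F n in sequentially. dist x y < real n"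
        using filterlim_real_sequentially by (auto simp: filterlim_at_top_dense)
      then show ?thesis by eventually_elim (use y in blast)
    qed
    then have "\<forall>\<^sub>F n in sequentially. \<forall>x\<in>?T. x \<in> ?S n"
      using finT by (intro eventually_ball_finite) blast+
    then have "\<forall>\<^sub>F n in sequentially. ennreal (card (mnnr_pairs (real n) (\<Phi> \<omega>))) = ennreal (card ?T)"
    proof eventually_elim
      case (elim n)
      then have "?S n = ?T" using sub[of n] by blast
      then show ?case unfolding card_mnnr_pairs by simp
    qed
    then show "(\<lambda>n. ennreal (card (mnnr_pairs (real n) (\<Phi> \<omega>)))) \<longlonglongrightarrow> ennreal (card ?T)"
      by (rule tendsto_eventually)
  next
    have "(\<lambda>n. F (real n)) \<longlonglongrightarrow> lam * pi / \<kappa> * (1 - 0)"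
      unfolding F_def
    proof (intro tendsto_intros filterlim_compose[OF exp_at_bot])
      have "filterlim (\<lambda>n. (lam * \<kappa>) * (real n)\<^sup>2) at_top sequentially"
        using assms(1) \<kappa> by (intro filterlim_tendsto_pos_mult_at_top[OF tendsto_const] filterlim_pow_at_top
            filterlim_real_sequentially) simp_all
      then show "filterlim (\<lambda>n. - lam * \<kappa> * (real n)\<^sup>2) at_bot sequentially"
        by (simp add: filterlim_uminus_at_bot)
    qed
    then show "(\<lambda>n. \<integral>\<^sup>+ \<omega>. ennreal (card (mnnr_pairs (real n) (\<Phi> \<omega>))) \<partial>M) \<longlonglongrightarrow> ennreal (lam * pi / \<kappa>)"
      by (simp add: expect tendsto_ennrealI)
  qed (rule mble[OF of_nat_0_le_iff])

  define A where "A = {\<phi>::pt set. \<phi> - {0} \<noteq> {} \<and> infdist 0 (\<phi> - {0}) \<le> r}"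
  let ?N = "\<lambda>\<omega>. {y \<in> mnnr_thinning (\<Phi> \<omega>) \<inter> unit_square. (\<lambda>z. z - y) ` mnnr_thinning (\<Phi> \<omega>) \<in> A}"
  have N: "?N \<omega> = {x \<in> unit_square. \<exists>y. mnnr (\<Phi> \<omega>) x y \<and> dist x y \<le> r}" for \<omega>
  proof (rule set_eqI)
    fix x
    show "x \<in> ?N \<omega> \<longleftrightarrow> x \<in> {x \<in> unit_square. \<exists>y. mnnr (\<Phi> \<omega>) x y \<and> dist x y \<le> r}"
    proof (cases "\<exists>y. mnnr (\<Phi> \<omega>) x y")
      case True
      then obtain y where y: "mnnr (\<Phi> \<omega>) x y" ..
      then have "(\<exists>y. mnnr (\<Phi> \<omega>) x y \<and> dist x y \<le> r) \<longleftrightarrow> dist x y \<le> r"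
        using mnnr_unique by blast
      moreover have "x \<in> mnnr_thinning (\<Phi> \<omega>)" using True unfolding mnnr_thinning_iff .
      ultimately show ?thesis
        using shifted_thinning_infdist_iff[OF y, of r] unfolding A_def by simp
    next
      case False
      then have "x \<notin> mnnr_thinning (\<Phi> \<omega>)" unfolding mnnr_thinning_iff .
      then show ?thesis using False by blast
    qed
  qed
  \<comment> \<open>The count with distance at most r is squeezed between the counts with distance
    less than r and less than r + 1/(n+1), and F is continuous.\<close>
  have num: "(\<integral>\<^sup>+ \<omega>. ennreal (card (?N \<omega>)) \<partial>M) = ennreal (F r)"
  proof (rule antisym)
    show "ennreal (F r) \<le> (\<integral>\<^sup>+ \<omega>. ennreal (card (?N \<omega>)) \<partial>M)"
      unfolding expect[OF assms(3), symmetric] N card_mnnr_pairs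
      by (intro nn_integral_mono ennreal_leI of_nat_mono card_mono fin) (auto intro: less_imp_le)
    have upper: "(\<integral>\<^sup>+ \<omega>. ennreal (card (?N \<omega>)) \<partial>M) \<le> ennreal (F (r + 1 / real (Suc n)))" for n
    proof -
      have r: "r < r + 1 / real (Suc n)" "0 \<le> r + 1 / real (Suc n)" using assms(3) by auto
      show ?thesis
        unfolding expect[OF r(2), symmetric] N card_mnnr_pairs
        by (intro nn_integral_mono ennreal_leI of_nat_mono card_mono fin) (blast intro: le_less_trans[OF _ r(1)])+
    qed
    have "(\<lambda>n. F (r + 1 / real (Suc n))) \<longlonglongrightarrow> F (r + 0)"
      unfolding F_def by (intro tendsto_intros LIMSEQ_Suc[OF lim_const_over_n])
    then have "(\<lambda>n. ennreal (F (r + 1 / real (Suc n)))) \<longlonglongrightarrow> ennreal (F r)"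
      by (simp add: tendsto_ennrealI)
    then show "(\<integral>\<^sup>+ \<omega>. ennreal (card (?N \<omega>)) \<partial>M) \<le> ennreal (F r)"
      by (rule LIMSEQ_le_const) (use upper in blast)
  qed

  have "nn_distribution M (\<lambda>\<omega>. mnnr_thinning (\<Phi> \<omega>)) r = F r / (lam * pi / \<kappa>)"
    unfolding nn_distribution_def palm_prob_def A_def[symmetric] num den
    using F0[of r] assms(1) \<kappa> by simp
  also have "\<dots> = 1 - exp (- lam * \<kappa> * r\<^sup>2)"
    using assms(1) \<kappa> by (simp add: F_def)
  also have "- lam * \<kappa> * r\<^sup>2 = - lam * pi * r\<^sup>2 * (2 - (2/3 - sqrt 3 / (2 * pi)))"
    by (simp add: \<kappa>_def field_simps)
  finally show ?thesis .
qed

end
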